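(* Let $d\ge 3$ and let $V:\mathbb Z^d\to\mathbb C$ be a potential with $V\in\ell^p(\mathbb Z^d)$, where $1\le p<\frac65$ if $d=3$ and $1\le p<\frac43$ if $d\ge4$. Then the following identities hold: $$\frac{\sigma(\mathbb T)}{2\pi}-B_0=\frac1{2\pi}\int_{-\pi}^{\pi}\log|D(e^{it})|\,dt\ge0,$$ $$B_1=\sum_{j=1}^N\Big(\frac1{z_j}-\overline{z_j}\Big)=\frac1\pi\int_{\mathbb T}e^{-it}d\mu(t),$$ $$\sum_{j=1}^N\Big(\frac1{z_j^2}-\overline{z_j}^{\,2}\Big)=\frac2{d^2}\operatorname{Tr}V^2+\frac1\pi\int_{\mathbb T}e^{-2it}d\mu(t),$$ $$B_n=\psi_n+\frac1\pi\int_{\mathbb T}e^{-int}d\mu(t),\qquad n=2,3,\dots,$$ where $B_0=\log B(0)=\log\big(\prod_{j=1}^N|z_j|\big)<0$ and $B_n=\frac1n\sum_{j=1}^N\big(\frac1{z_j^n}-\overline{z_j}^{\,n}\big)$ for $n\ge1$. In particular, $$\sum_{j=1}^N\big(\operatorname{Re}\varkappa_j+i\operatorname{Im}\lambda_j\big)=\frac d{2\pi}\int_{\mathbb T}e^{-it}d\mu(t),$$ $$\sum_{j=1}^N\Big[(\varkappa_{j1}\lambda_{j1}-\lambda_{j2}\varkappa_{j2})+i(\lambda_{j1}\lambda_{j2}+\varkappa_{j1}\varkappa_{j2})\Big]=\frac12\operatorname{Tr}V^2+\frac{d^2}{4\pi}\int_{\mathbb T}e^{-2it}d\mu(t),$$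 where $\varkappa_j=\sqrt{\lambda_j^2-d^2}=\varkappa_{j1}+i\varkappa_{j2}$ and $\lambda_j=\lambda_{j1}+i\lambda_{j2}$ (real and imaginary parts).
   Context: The discrete Laplacian on $\ell^2(\mathbb Z^d)$ is $(\Delta f)(n)=\frac12\sum_{|n-m|=1}f_m$; its spectrum is $[-d,d]$. $V$ acts as multiplication, $(Vf)(n)=V_nf_n$, and $H=\Delta+V$. Let $\Lambda=\mathbb C\setminus[-d,d]$, $\mathbb D=\{|z|<1\}$, $\mathbb T=\mathbb R/2\pi\mathbb Z$. The map $\lambda(z)=\frac d2\left(z+\frac1z\right)$ is a conformal mapping of $\mathbb D$ onto $\Lambda$ (with $0\mapsto\infty$). The branch of $\varkappa(\lambda)=\sqrt{\lambda^2-d^2}$ on $\Lambda$ is fixed by $\varkappa=\lambda-\frac{d^2}{2\lambda}+O(\lambda^{-3})$ as $|\lambda|\to\infty$. With $R_0(\lambda)=(\Delta-\lambda)^{-1}$, set $\mathcal D(\lambda)=\det\big[(I+VR_0(\lambda))e^{-VR_0(\lambda)}\big]$ for $\lambda\in\Lambda$ (regularized determinant), and $D(z)=\mathcal D(\lambda(z))$, $z\in\mathbb D$, with $D(0)=1$. $D$ is bounded and analytic in $\mathbb D$ and Hölder up to the boundary. Let $\{z_j\}_{j=1}^N$, $N\le\infty$, be its zeros in $\mathbb D$ counted with multiplicity; the $\lambda_j=\lambda(z_j)$ are the eigenvalues of $H$ in $\Lambda$. The Blaschke product is $B=1$ if $N=0$, and $B(z)=\prod_{j=1}^N\frac{|z_j|}{z_j}\frac{z_j-z}{1-\overline{z_j}z}$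 if $N\ge1$. The numbers $\psi_n$ are the coefficients in the Taylor series $\log D(z)=-\sum_{n\ge2}\psi_nz^n$ near $z=0$ (branch $\log D(0)=0$). The measure $\sigma\ge0$ is the singular measure on $[-\pi,\pi]$ (viewed on $\mathbb T$) in the canonical factorization $$D(z)=B(z)\exp\Big(-\frac1{2\pi}\int_{-\pi}^\pi\frac{e^{it}+z}{e^{it}-z}d\sigma(t)\Big)\exp\Big(\frac1{2\pi}\int_{-\pi}^\pi\frac{e^{it}+z}{e^{it}-z}\log|D(e^{it})|dt\Big),\quad |z|<1,$$ with $\log|D(e^{it})|\in L^1(-\pi,\pi)$, and $d\mu(t)=\log|D(e^{it})|\,dt-d\sigma(t)$.
   Formalization: The left sides of the third and the last display carry a factor 1/2 that is missing in the text (needed for agreement with B_2 = ψ_2 + …, as ψ_2 = (2/d²) Tr V²), and B_0 < 0 is claimed only for N ≥ 1, since B_0 = 0 when N = 0. *)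

theory Defs
  imports "HOL-Complex_Analysis.Complex_Analysis" "HOL-Library.Landau_Symbols"
begin

text \<open>
  The lattice \<open>Z^d\<close> is the type \<open>int ^ 'd\<close>, with \<open>d = CARD('d)\<close>.
  Operators on \<open>\<ell>\<^sup>2\<close> are represented by maps on complex functions, of which only the
  action on the carrier \<open>ell2\<close> matters.
\<close>

type_synonym 'a operator = "('a \<Rightarrow> complex) \<Rightarrow> ('a \<Rightarrow> complex)"

definition ellp :: "real \<Rightarrow> ('a \<Rightarrow> complex) set" where
  "ellp p = {f. (\<lambda>n. cmod (f n) powr p) summable_on UNIV}"

definition ell2 :: "('a \<Rightarrow> complex) set" where
  "ell2 = {f. (\<lambda>n. (cmod (f n))\<^sup>2) summable_on UNIV}"

definition delta :: "'a \<Rightarrow> 'a \<Rightarrow> complex" where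
  "delta m n = (if n = m then 1 else 0)"

definition laplacian :: "(int ^ 'd::finite) operator" where
  "laplacian f n =
     1 / 2 * (\<Sum>m | norm (\<chi> i. real_of_int (n $ i - m $ i)) = 1. f m)"

definition mult_op :: "('a \<Rightarrow> complex) \<Rightarrow> 'a operator" where
  "mult_op V f n = V n * f n"

text \<open>For \<open>l\<close> outside \<open>[-d,d]\<close> the map inverted here is a bijection of \<open>ell2\<close>.\<close>

definition R0 :: "complex \<Rightarrow> (int ^ 'd::finite) operator" where
  "R0 l = inv_into ell2 (\<lambda>g n. laplacian g n - l * g n)"

text \<open>
  The exponential series converges in operator norm when \<open>A\<close> is bounded on \<open>ell2\<close>; its value is
  then given by the coordinatewise sums.
\<close>

definition op_exp :: "'a operator \<Rightarrow> 'a operator" where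
  "op_exp A f n = (\<Sum>k. (A ^^ k) f n / fact k)"

definition op_trace :: "'a operator \<Rightarrow> complex" where
  "op_trace M = (\<Sum>\<^sub>\<infinity>n. M (delta n) n)"

text \<open>
  Fredholm determinant of \<open>M = I + T\<close>, \<open>T\<close> trace class: \<open>det (I + T)\<close> is the sum over \<open>k\<close> of the
  traces of the exterior powers of \<open>T\<close>. In the standard basis the \<open>k\<close>-th trace is the sum of the
  principal minors of \<open>T\<close> over the \<open>k\<close>-element sets of indices; all these minors together are
  absolutely summable.
\<close>

definition op_det :: "'a operator \<Rightarrow> complex" where
  "op_det M =
     (\<Sum>\<^sub>\<infinity>S\<in>{S. finite S}.
        \<Sum>s | s permutes S. of_int (sign s) * (\<Prod>i\<in>S. M (delta (s i)) i - delta (s i) i))"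

definition reg_det :: "'a operator \<Rightarrow> complex" where
  "reg_det A = op_det (\<lambda>f. let g = op_exp (\<lambda>h n. - A h n) f in (\<lambda>n. g n + A g n))"

definition Dcal :: "(int ^ 'd::finite \<Rightarrow> complex) \<Rightarrow> complex \<Rightarrow> complex" where
  "Dcal V l = reg_det (mult_op V \<circ> R0 l)"

definition Lambda :: "real \<Rightarrow> complex set" where
  "Lambda d = - (complex_of_real ` {-d..d})"

definition lam :: "real \<Rightarrow> complex \<Rightarrow> complex" where
  "lam d z = of_real d / 2 * (z + 1 / z)"

definition Ddisc :: "(int ^ 'd::finite \<Rightarrow> complex) \<Rightarrow> complex \<Rightarrow> complex" where
  "Ddisc V z = (if z = 0 then 1 else Dcal V (lam (real CARD('d)) z))"

text \<open>The value \<open>D(e\<^sup>i\<^sup>t)\<close> of the extension of \<open>D\<close> to the closed disc by continuity.\<close>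

definition Dbdry :: "(int ^ 'd::finite \<Rightarrow> complex) \<Rightarrow> real \<Rightarrow> complex" where
  "Dbdry V t = Lim (at (cis t) within ball 0 1) (Ddisc V)"

definition psi :: "(int ^ 'd::finite \<Rightarrow> complex) \<Rightarrow> nat \<Rightarrow> complex" where
  "psi V n = - ((deriv ^^ n) (\<lambda>z. Ln (Ddisc V z)) 0 / fact n)"

definition is_kappa :: "real \<Rightarrow> (complex \<Rightarrow> complex) \<Rightarrow> bool" where
  "is_kappa d \<kappa> \<longleftrightarrow>
     \<kappa> holomorphic_on Lambda d \<and>
     (\<forall>l\<in>Lambda d. (\<kappa> l)\<^sup>2 = l\<^sup>2 - (of_real d)\<^sup>2) \<and>
     (\<lambda>l. \<kappa> l - (l - (of_real d)\<^sup>2 / (2 * l))) \<in> O[at_infinity](\<lambda>l. 1 / l ^ 3)"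

text \<open>Index set \<open>1, \<dots>, N\<close>, where \<open>N = \<infinity>\<close> is allowed.\<close>

definition idx :: "enat \<Rightarrow> nat set" where
  "idx N = {j. 1 \<le> j \<and> enat j \<le> N}"

definition enumerates_zeros :: "(complex \<Rightarrow> complex) \<Rightarrow> enat \<Rightarrow> (nat \<Rightarrow> complex) \<Rightarrow> bool" where
  "enumerates_zeros f N z \<longleftrightarrow>
     (\<forall>j\<in>idx N. z j \<in> ball 0 1 \<and> f (z j) = 0) \<and>
     (\<forall>w\<in>ball 0 1. f w = 0 \<longrightarrow>
        finite {j\<in>idx N. z j = w} \<and> int (card {j\<in>idx N. z j = w}) = zorder f w)"

text \<open>For finite \<open>N\<close> the partial products below are eventually constant; for \<open>N = 0\<close> they are \<open>1\<close>.\<close>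

definition blaschke :: "enat \<Rightarrow> (nat \<Rightarrow> complex) \<Rightarrow> complex \<Rightarrow> complex" where
  "blaschke N z w =
     lim (\<lambda>n. \<Prod>j\<in>idx N \<inter> {..n}.
       of_real (cmod (z j)) / z j * ((z j - w) / (1 - cnj (z j) * w)))"

definition B0 :: "enat \<Rightarrow> (nat \<Rightarrow> complex) \<Rightarrow> real" where
  "B0 N z = ln (lim (\<lambda>n. \<Prod>j\<in>idx N \<inter> {..n}. cmod (z j)))"

definition Bcoeff :: "enat \<Rightarrow> (nat \<Rightarrow> complex) \<Rightarrow> nat \<Rightarrow> complex" where
  "Bcoeff N z n = 1 / of_nat n * (\<Sum>\<^sub>\<infinity>j\<in>idx N. 1 / z j ^ n - cnj (z j) ^ n)"

definition is_singular_measure ::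
  "(int ^ 'd::finite \<Rightarrow> complex) \<Rightarrow> enat \<Rightarrow> (nat \<Rightarrow> complex) \<Rightarrow> real measure \<Rightarrow> bool" where
  "is_singular_measure V N z \<sigma> \<longleftrightarrow>
     finite_measure \<sigma> \<and>
     sets \<sigma> = sets (restrict_space borel {-pi..pi}) \<and>
     (\<exists>E\<in>sets \<sigma>. emeasure lborel E = 0 \<and> emeasure \<sigma> ({-pi..pi} - E) = 0) \<and>
     set_integrable lborel {-pi..pi} (\<lambda>t. ln (cmod (Dbdry V t))) \<and>
     (\<forall>w\<in>ball 0 1. Ddisc V w =
        blaschke N z w *
        exp (- (1 / (2 * of_real pi)) * (LINT t|\<sigma>. (cis t + w) / (cis t - w))) *
        exp (1 / (2 * of_real pi) *
          (LINT t:{-pi..pi}|lborel.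
             (cis t + w) / (cis t - w) * of_real (ln (cmod (Dbdry V t))))))"

text \<open>Integral of \<open>f\<close> against the signed measure \<open>log |D(e\<^sup>i\<^sup>t)| dt - d\<sigma>(t)\<close>.\<close>

definition mu_integral ::
  "(int ^ 'd::finite \<Rightarrow> complex) \<Rightarrow> real measure \<Rightarrow> (real \<Rightarrow> complex) \<Rightarrow> complex" where
  "mu_integral V \<sigma> f =
     (LINT t:{-pi..pi}|lborel. f t * of_real (ln (cmod (Dbdry V t)))) - (LINT t|\<sigma>. f t)"

end

(*
  At z = 0 the canonical factorization reads 1 = B(0) exp(real number), so the product L of the
  |z_j| is positive: this is the Blaschke condition, and all zeros satisfy |z_j| >= L. On |z| < L
  every factor of the factorization is the exponential of an explicit power series, so that
  D = exp G with G(z) = sum_{n >= 1} (1/pi int e^{-int} dmu - B_n) z^n. Comparing with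
  log D = - sum psi_n z^n gives the identities, once psi_1 = 0 and psi_2 = (2/d^2) Tr V^2 are known.

  These two coefficients follow from D(z) = 1 - (2/d^2) (Tr V^2) z^2 + O(z^3), that is, from
  det((I + A) e^{-A}) = 1 - Tr V^2 / (2 l^2) + O(l^{-3}) for A = V R0(l) and large l. Here
  (I + A) e^{-A} = I + T with T = -A^2/2 + O(|A| A^2), the Neumann series gives
  sum_j ||A^2 delta_j||_1 = O(||V||_2^2 / l^2), and a principal minor of T is at most the product of
  the l^1 norms of its columns.
*)
theory Submission imports Defs begin

subsection \<open>The Laplacian on summable functions\<close>

text \<open>The estimates use l^1 norms of columns and row sums rather than Schatten norms, because
  \<open>op_det\<close> is built from minors in the standard basis: all that enters are images of
  the functions \<open>delta j\<close>. These are summable, and on summable functions the resolvent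
  is an explicit series. The obstacle is that V need not be in l^1 and is controlled through its l^2
  norm. The column norms of A = V R0(l) add up to a multiple of the l^1 norm of V, possibly
  infinite. Those of A^2 do not: summing over the columns first leaves a quadratic form evaluated at
  |V|, which the l^2 norm bounds. The factor e^{-A} removes exactly the first-order term, and every
  remainder has to be kept as a small factor times A^2. An error of order l^{-3} is enough because
  lambda(z) behaves like d/(2z), so it becomes O(z^3) in the disc. No Taylor expansion of D is
  presupposed there: the factorization supplies D = exp G, and the limit of (D - 1)/z^2 at 0
  identifies the first coefficients of G.\<close>

text \<open>Bounding finite sums keeps summability and the norm estimate in one fact, so that no
  infinite sum has to be handled until the determinant is formed.\<close>

definition l1_le :: "('a \<Rightarrow> complex) \<Rightarrow> real \<Rightarrow> bool" where
  "l1_le f C \<longleftrightarrow> (\<forall>F. finite F \<longrightarrow> (\<Sum>n\<in>F. cmod (f n)) \<le> C)"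

lemma l1_leD: "l1_le f C \<Longrightarrow> finite F \<Longrightarrow> (\<Sum>n\<in>F. cmod (f n)) \<le> C"
  by (simp add: l1_le_def)

lemma l1_le_nonneg: "l1_le f C \<Longrightarrow> 0 \<le> C"
  using l1_leD[of f C "{}"] by simp

lemma l1_le_point: "l1_le f C \<Longrightarrow> cmod (f n) \<le> C"
  using l1_leD[of f C "{n}"] by simp

lemma l1_le_mono: "l1_le f C \<Longrightarrow> C \<le> D \<Longrightarrow> l1_le f D"
  unfolding l1_le_def by (meson order_trans)

lemma l1_le_add:
  assumes "l1_le f C" "l1_le g D"
  shows "l1_le (\<lambda>n. f n + g n) (C + D)"
  unfolding l1_le_def
proof (intro allI impI)
  fix F :: "'a set" assume "finite F"
  have "(\<Sum>n\<in>F. cmod (f n + g n)) \<le> (\<Sum>n\<in>F. cmod (f n) + cmod (g n))"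
    by (intro sum_mono norm_triangle_ineq)
  then show "(\<Sum>n\<in>F. cmod (f n + g n)) \<le> C + D"
    using l1_leD[OF assms(1) \<open>finite F\<close>] l1_leD[OF assms(2) \<open>finite F\<close>]
    by (simp add: sum.distrib)
qed

lemma l1_le_mult:
  assumes "\<And>n. cmod (V n) \<le> M" "l1_le f C"
  shows "l1_le (\<lambda>n. V n * f n) (M * C)"
  unfolding l1_le_def
proof (intro allI impI)
  fix F :: "'a set" assume F: "finite F"
  have M: "0 \<le> M" using assms(1)[of undefined] norm_ge_zero order_trans by blast
  have "(\<Sum>n\<in>F. cmod (V n * f n)) \<le> (\<Sum>n\<in>F. M * cmod (f n))"
    by (intro sum_mono) (simp add: norm_mult mult_right_mono assms)
  also have "\<dots> = M * (\<Sum>n\<in>F. cmod (f n))" by (simp add: sum_distrib_left)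
  also have "\<dots> \<le> M * C" using l1_leD[OF assms(2) F] M by (rule mult_left_mono)
  finally show "(\<Sum>n\<in>F. cmod (V n * f n)) \<le> M * C" .
qed

lemma l1_le_cmult: "l1_le f C \<Longrightarrow> l1_le (\<lambda>n. c * f n) (cmod c * C)"
  by (rule l1_le_mult) auto

text \<open>The triangle inequality of l^1 for pointwise series: a finite sum over points commutes
  with the series. It serves both the Neumann series and the exponential.\<close>

lemma l1_le_suminf:
  assumes g: "\<And>k. l1_le (g k) (C k)" and C: "summable C"
  shows "l1_le (\<lambda>n. \<Sum>k. g k n) (\<Sum>k. C k)" and "summable (\<lambda>k. g k n)"
proof -
  have s: "summable (\<lambda>k. cmod (g k n))" for n
    by (rule summable_comparison_test'[OF C, of 0]) (use l1_le_point[OF g] in auto)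
  then show "summable (\<lambda>k. g k n)" by (rule summable_norm_cancel)
  show "l1_le (\<lambda>n. \<Sum>k. g k n) (\<Sum>k. C k)"
    unfolding l1_le_def
  proof (intro allI impI)
    fix F :: "'a set" assume F: "finite F"
    have "(\<Sum>n\<in>F. cmod (\<Sum>k. g k n)) \<le> (\<Sum>n\<in>F. \<Sum>k. cmod (g k n))"
      by (intro sum_mono summable_norm s)
    also have "\<dots> = (\<Sum>k. \<Sum>n\<in>F. cmod (g k n))"
      by (rule suminf_sum[symmetric]) (rule s)
    also have "\<dots> \<le> (\<Sum>k. C k)"
      by (intro suminf_le summable_sum s C l1_leD[OF g F])
    finally show "(\<Sum>n\<in>F. cmod (\<Sum>k. g k n)) \<le> (\<Sum>k. C k)" .
  qed
qed

lemma l1_le_delta: "l1_le (delta m) 1"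
  unfolding l1_le_def
proof (intro allI impI)
  fix F :: "'a set" assume "finite F"
  then show "(\<Sum>n\<in>F. cmod (delta m n)) \<le> 1"
    by (simp add: delta_def if_distrib[of cmod] cong: if_cong)
qed

text \<open>Links the l^1 estimates to \<open>R0\<close>, which is an inverse on
  \<open>ell2\<close>.\<close>

lemma l1_le_imp_ell2:
  assumes "l1_le f C" shows "f \<in> ell2"
  unfolding ell2_def
proof (intro CollectI nonneg_bdd_above_summable_on bdd_aboveI2)
  fix F :: "'a set" assume "F \<in> {F. F \<subseteq> UNIV \<and> finite F}"
  then have F: "finite F" by simp
  have "(\<Sum>n\<in>F. (cmod (f n))\<^sup>2) \<le> (\<Sum>n\<in>F. C * cmod (f n))"
    by (intro sum_mono) (simp add: power2_eq_square mult_right_mono l1_le_point[OF assms])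
  also have "\<dots> \<le> C * C"
    using l1_leD[OF assms F] l1_le_nonneg[OF assms]
    by (simp flip: sum_distrib_left add: mult_left_mono)
  finally show "(\<Sum>n\<in>F. (cmod (f n))\<^sup>2) \<le> C * C" .
qed auto

section \<open>Nearest neighbours and norm bounds for the lattice Laplacian\<close>

definition unit_steps :: "(int ^ 'd::finite) set" where
  "unit_steps = {e. norm (\<chi> i. real_of_int (e $ i)) = 1}"

text \<open>Integer squares that add up to 1 are all zero except for a single 1.\<close>

lemma unit_steps_subset:
  "(unit_steps :: (int ^ 'd::finite) set) \<subseteq> (\<lambda>(i, s). axis i s) ` (UNIV \<times> {1, -1})"
proof
  fix e :: "int ^ 'd" assume "e \<in> unit_steps"
  then have "(\<Sum>i\<in>UNIV. (real_of_int (e $ i))\<^sup>2) = 1"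
    by (simp add: unit_steps_def norm_vec_def L2_set_def)
  then have "real_of_int (\<Sum>i\<in>UNIV. (e $ i)\<^sup>2) = 1" by simp
  then have s: "(\<Sum>i\<in>UNIV. (e $ i)\<^sup>2) = 1" by linarith
  then obtain i where i: "e $ i \<noteq> 0" by (metis (no_types, lifting) power_zero_numeral sum.neutral zero_neq_one)
  have "(\<Sum>i\<in>UNIV. (e $ i)\<^sup>2) = (e $ i)\<^sup>2 + (\<Sum>j\<in>UNIV-{i}. (e $ j)\<^sup>2)"
    by (rule sum.remove) auto
  moreover have "(e $ i)\<^sup>2 > 0" using i by simp
  moreover have "(\<Sum>j\<in>UNIV-{i}. (e $ j)\<^sup>2) \<ge> 0" by (simp add: sum_nonneg)
  ultimately have 1: "(e $ i)\<^sup>2 = 1" and 0: "(\<Sum>j\<in>UNIV-{i}. (e $ j)\<^sup>2) = 0"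
    using s by linarith+
  have "e $ j = 0" if "j \<noteq> i" for j
    using 0 that by (simp add: sum_nonneg_eq_0_iff)
  then have "e = axis i (e $ i)" by (auto simp: vec_eq_iff axis_def)
  moreover have "e $ i \<in> {1, -1}" using 1 by (auto simp: power2_eq_1_iff)
  ultimately show "e \<in> (\<lambda>(i, s). axis i s) ` (UNIV \<times> {1, -1})" by (auto simp: image_iff)
qed

lemma finite_unit_steps [simp]: "finite (unit_steps :: (int ^ 'd::finite) set)"
  by (rule finite_subset[OF unit_steps_subset]) auto

lemma card_unit_steps: "card (unit_steps :: (int ^ 'd::finite) set) \<le> 2 * CARD('d)"
proof -
  have "card (unit_steps :: (int ^ 'd) set) \<le> card ((UNIV :: 'd set) \<times> {1 :: int, -1})"
    by (rule order_trans[OF card_mono[OF _ unit_steps_subset] card_image_le]) auto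
  then show ?thesis by (simp add: card_cartesian_product)
qed

lemma laplacian_eq: "laplacian f n = 1 / 2 * (\<Sum>e\<in>unit_steps. f (n - e))"
proof -
  have "(\<Sum>m | norm (\<chi> i. real_of_int (n $ i - m $ i)) = 1. f m) = (\<Sum>e\<in>unit_steps. f (n - e))"
    by (rule sum.reindex_bij_witness[of _ "\<lambda>e. n - e" "\<lambda>m. n - m"]) (auto simp: unit_steps_def)
  then show ?thesis by (simp add: laplacian_def)
qed

text \<open>The kernel of the Laplacian is nonnegative, so its real version is monotone and
  dominates absolute values through all powers.\<close>

definition abs_laplacian :: "(int ^ 'd::finite \<Rightarrow> real) \<Rightarrow> int ^ 'd \<Rightarrow> real" where
  "abs_laplacian v n = 1 / 2 * (\<Sum>e\<in>unit_steps. v (n - e))"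

lemma cmod_laplacian_le: "cmod (laplacian f n) \<le> abs_laplacian (\<lambda>n. cmod (f n)) n"
  by (simp add: laplacian_eq abs_laplacian_def norm_mult norm_sum)

text \<open>With \<open>u j\<close> the columns of a matrix, the sum over \<open>j\<close> at a
  fixed point \<open>i\<close> is a row sum. Row sums of a product are controlled by applying the
  positive kernel to the row sums of the right factor.\<close>

lemma sum_laplacian_power_le:
  fixes u :: "'j \<Rightarrow> int ^ 'd::finite \<Rightarrow> complex"
  assumes "\<And>i. (\<Sum>j\<in>G. cmod (u j i)) \<le> h i"
  shows "(\<Sum>j\<in>G. cmod ((laplacian ^^ k) (u j) i)) \<le> (abs_laplacian ^^ k) h i"
proof (induction k arbitrary: i)
  case 0 show ?case using assms by simp
next
  case (Suc k)
  have "(\<Sum>j\<in>G. cmod ((laplacian ^^ Suc k) (u j) i))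
      \<le> (\<Sum>j\<in>G. abs_laplacian (\<lambda>n. cmod ((laplacian ^^ k) (u j) n)) i)"
    using cmod_laplacian_le by (auto intro: sum_mono)
  also have "\<dots> = 1 / 2 * (\<Sum>e\<in>unit_steps. \<Sum>j\<in>G. cmod ((laplacian ^^ k) (u j) (i - e)))"
    unfolding abs_laplacian_def sum_distrib_left[symmetric] by (subst sum.swap) simp
  also have "\<dots> \<le> abs_laplacian ((abs_laplacian ^^ k) h) i"
    unfolding abs_laplacian_def[of "(abs_laplacian ^^ k) h"]
    by (intro mult_left_mono sum_mono Suc.IH) auto
  finally show ?case by simp
qed

lemma laplacian_linear:
  "laplacian (\<lambda>n. f n + c * g n) n = laplacian f n + c * laplacian g n"
  by (simp add: laplacian_eq sum.distrib sum_distrib_left algebra_simps)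

lemma laplacian_power_linear:
  "(laplacian ^^ k) (\<lambda>n. f n + c * g n) = (\<lambda>n. (laplacian ^^ k) f n + c * (laplacian ^^ k) g n)"
  by (induction k) (simp_all add: laplacian_linear)

text \<open>Half the number of neighbours is at most \<open>d\<close>. This is the source of the
  norm bound \<open>d\<close> for the Laplacian, used below in l^1, in the supremum norm and in
  l^2.\<close>

lemma half_card_unit_steps:
  "0 \<le> x \<Longrightarrow> 1 / 2 * (real (card (unit_steps :: (int ^ 'd::finite) set)) * x) \<le> real CARD('d) * x"
  using mult_right_mono[of "real (card (unit_steps :: (int ^ 'd) set))" "2 * real CARD('d)" x]
    card_unit_steps[where 'd = 'd] by simp

lemma sum_shift_le:
  fixes v :: "'a::ab_group_add \<Rightarrow> real"
  assumes "\<And>F. finite F \<Longrightarrow> (\<Sum>n\<in>F. v n) \<le> C" "finite F"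
  shows "(\<Sum>n\<in>F. v (n - e)) \<le> C"
proof -
  have "(\<Sum>n\<in>F. v (n - e)) = (\<Sum>n\<in>(\<lambda>n. n - e) ` F. v n)"
    by (subst sum.reindex) (auto simp: inj_on_def)
  then show ?thesis using assms by simp
qed

lemma l1_le_laplacian:
  fixes f :: "int ^ 'd::finite \<Rightarrow> complex"
  assumes "l1_le f C" shows "l1_le (laplacian f) (real CARD('d) * C)"
  unfolding l1_le_def
proof (intro allI impI)
  fix F :: "(int ^ 'd) set" assume F: "finite F"
  have "(\<Sum>n\<in>F. cmod (laplacian f n)) \<le> (\<Sum>n\<in>F. abs_laplacian (\<lambda>n. cmod (f n)) n)"
    by (intro sum_mono cmod_laplacian_le)
  also have "\<dots> = 1 / 2 * (\<Sum>e\<in>unit_steps. \<Sum>n\<in>F. cmod (f (n - e)))"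
    unfolding abs_laplacian_def sum_distrib_left[symmetric] by (subst sum.swap) simp
  also have "\<dots> \<le> 1 / 2 * (\<Sum>e\<in>(unit_steps :: (int ^ 'd) set). C)"
    by (intro mult_left_mono sum_mono sum_shift_le[of "\<lambda>n. cmod (f n)"] F l1_leD[OF assms]) auto
  also have "\<dots> \<le> real CARD('d) * C"
    using half_card_unit_steps[OF l1_le_nonneg[OF assms], where 'd = 'd] by simp
  finally show "(\<Sum>n\<in>F. cmod (laplacian f n)) \<le> real CARD('d) * C" .
qed

lemma l1_le_laplacian_power:
  fixes f :: "int ^ 'd::finite \<Rightarrow> complex"
  assumes "l1_le f C" shows "l1_le ((laplacian ^^ k) f) (real CARD('d) ^ k * C)"
  by (induction k) (use assms l1_le_laplacian in \<open>auto simp: mult.assoc\<close>)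

lemma abs_laplacian_power_const:
  "c \<ge> 0 \<Longrightarrow> (abs_laplacian ^^ k) (\<lambda>_. c) (i :: int ^ 'd::finite) \<le> real CARD('d) ^ k * c"
proof (induction k arbitrary: i)
  case (Suc k)
  have "abs_laplacian ((abs_laplacian ^^ k) (\<lambda>_. c)) i
      \<le> 1 / 2 * (\<Sum>e\<in>(unit_steps :: (int ^ 'd) set). real CARD('d) ^ k * c)"
    unfolding abs_laplacian_def[of "(abs_laplacian ^^ k) (\<lambda>_. c)"]
    by (intro mult_left_mono sum_mono Suc) auto
  also have "\<dots> \<le> real CARD('d) * (real CARD('d) ^ k * c)"
    using half_card_unit_steps[of "real CARD('d) ^ k * c", where 'd = 'd] Suc.prems by simp
  finally show ?case by (simp add: mult.assoc)
qed simp

text \<open>Cauchy-Schwarz over the neighbours of a point costs one factor of half their number;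
  counting each shifted square once per neighbour costs the second.\<close>

lemma sum_power2_abs_laplacian_le:
  fixes v :: "int ^ 'd::finite \<Rightarrow> real"
  assumes v: "\<And>F. finite F \<Longrightarrow> (\<Sum>n\<in>F. (v n)\<^sup>2) \<le> S" and F: "finite F"
  shows "(\<Sum>n\<in>F. (abs_laplacian v n)\<^sup>2) \<le> (real CARD('d))\<^sup>2 * S"
proof -
  let ?E = "unit_steps :: (int ^ 'd) set"
  have S: "0 \<le> S" using v[of "{}"] by simp
  have "(\<Sum>n\<in>F. (abs_laplacian v n)\<^sup>2)
      \<le> (\<Sum>n\<in>F. 1 / 4 * (real (card ?E) * (\<Sum>e\<in>?E. (v (n - e))\<^sup>2)))"
  proof (rule sum_mono)
    fix n
    have "(\<Sum>e\<in>?E. v (n - e))\<^sup>2 \<le> real (card ?E) * (\<Sum>e\<in>?E. (v (n - e))\<^sup>2)"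
      using sum_squared_le_sum_of_squares[of "\<lambda>e. v (n - e)" ?E] by (simp add: mult.commute)
    then show "(abs_laplacian v n)\<^sup>2 \<le> 1 / 4 * (real (card ?E) * (\<Sum>e\<in>?E. (v (n - e))\<^sup>2))"
      by (simp add: abs_laplacian_def power_divide)
  qed
  also have "\<dots> = 1 / 4 * (real (card ?E) * (\<Sum>e\<in>?E. \<Sum>n\<in>F. (v (n - e))\<^sup>2))"
    unfolding sum_distrib_left[symmetric] by (subst sum.swap) simp
  also have "\<dots> \<le> 1 / 4 * (real (card ?E) * (\<Sum>e\<in>?E. S))"
    by (intro mult_left_mono sum_mono sum_shift_le[of "\<lambda>n. (v n)\<^sup>2"] F v) auto
  also have "\<dots> = (1 / 2 * real (card ?E)) * (1 / 2 * (real (card ?E) * S))" by simp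
  also have "\<dots> \<le> real CARD('d) * (real CARD('d) * S)"
  proof (rule mult_mono)
    show "1 / 2 * real (card ?E) \<le> real CARD('d)"
      using half_card_unit_steps[of 1, where 'd = 'd] by simp
  qed (use half_card_unit_steps[OF S, where 'd = 'd] S in auto)
  finally show ?thesis by (simp add: power2_eq_square mult.assoc)
qed

text \<open>The quadratic form bound through which the l^2 norm of the potential enters; it is
  applied with \<open>v\<close> = |V|.\<close>

lemma sum_mult_abs_laplacian_power_le:
  fixes v :: "int ^ 'd::finite \<Rightarrow> real"
  assumes v: "\<And>F. finite F \<Longrightarrow> (\<Sum>n\<in>F. (v n)\<^sup>2) \<le> S" and F: "finite F"
  shows "(\<Sum>n\<in>F. v n * (abs_laplacian ^^ k) v n) \<le> real CARD('d) ^ k * S"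
proof -
  let ?c = "real CARD('d) ^ k"
  have c: "?c > 0" by simp
  have sq: "(\<Sum>n\<in>F. ((abs_laplacian ^^ k) v n)\<^sup>2) \<le> ?c\<^sup>2 * S"
    using F
  proof (induction k arbitrary: F)
    case (Suc k)
    from sum_power2_abs_laplacian_le[OF Suc.IH Suc.prems]
    show ?case by (simp add: power_mult_distrib mult.assoc)
  qed (use v in simp)
  \<comment> \<open>The inequality x y <= c x^2 / 2 + y^2 / (2 c) with c = \<open>?c\<close>: by
    \<open>sq\<close> the squares of the second factor add up to at most c^2 S, so both halves
    contribute c S / 2.\<close>
  have "(\<Sum>n\<in>F. v n * (abs_laplacian ^^ k) v n)
      \<le> (\<Sum>n\<in>F. ?c / 2 * (v n)\<^sup>2 + ((abs_laplacian ^^ k) v n)\<^sup>2 / (2 * ?c))"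
  proof (rule sum_mono)
    fix n
    have "0 \<le> (?c * v n - (abs_laplacian ^^ k) v n)\<^sup>2 / (2 * ?c)" using c by simp
    also have "\<dots> = ?c / 2 * (v n)\<^sup>2 + ((abs_laplacian ^^ k) v n)\<^sup>2 / (2 * ?c)
        - v n * (abs_laplacian ^^ k) v n"
      using c by (simp add: power2_eq_square field_simps)
    finally show "v n * (abs_laplacian ^^ k) v n
        \<le> ?c / 2 * (v n)\<^sup>2 + ((abs_laplacian ^^ k) v n)\<^sup>2 / (2 * ?c)" by simp
  qed
  also have "\<dots> = ?c / 2 * (\<Sum>n\<in>F. (v n)\<^sup>2)
      + (\<Sum>n\<in>F. ((abs_laplacian ^^ k) v n)\<^sup>2) / (2 * ?c)"
    by (simp add: sum.distrib sum_distrib_left sum_divide_distrib)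
  also have "\<dots> \<le> ?c / 2 * S + ?c\<^sup>2 * S / (2 * ?c)"
    using c by (intro add_mono mult_left_mono divide_right_mono v F sq) auto
  also have "\<dots> = ?c * S" using c by (simp add: power2_eq_square)
  finally show ?thesis .
qed

subsection \<open>The Neumann series of the free resolvent\<close>

text \<open>The tail from order \<open>m\<close> of the series of (Laplacian - l)^{-1} in powers of
  the Laplacian. \<open>m = 0\<close> is the resolvent itself; \<open>m = 1\<close> is what remains
  after its leading term -1/l.\<close>

definition neumann :: "nat \<Rightarrow> complex \<Rightarrow> (int ^ 'd::finite) operator" where
  "neumann m l f n = (\<Sum>k. - (laplacian ^^ (k + m)) f n / l ^ (k + m + 1))"

text \<open>Kept as a series because the estimates are termwise; its closed form shows decay of
  order |l|^{-(m+1)}.\<close>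

definition neumann_bound :: "real \<Rightarrow> nat \<Rightarrow> complex \<Rightarrow> real" where
  "neumann_bound d m l = (\<Sum>k. d ^ (k + m) / cmod l ^ (k + m + 1))"

lemma neumann_bound_sums:
  assumes "0 \<le> d" "d < cmod l"
  shows "(\<lambda>k. d ^ (k + m) / cmod l ^ (k + m + 1)) sums (d ^ m / (cmod l ^ m * (cmod l - d)))"
proof -
  have l: "cmod l > 0" using assms by linarith
  have "(\<lambda>k. (d ^ m / cmod l ^ (m + 1)) * (d / cmod l) ^ k) sums
      ((d ^ m / cmod l ^ (m + 1)) * (1 / (1 - d / cmod l)))"
    using assms l by (intro sums_mult geometric_sums) auto
  moreover have "(d ^ m / cmod l ^ (m + 1)) * (1 / (1 - d / cmod l)) = d ^ m / (cmod l ^ m * (cmod l - d))"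
    using l assms by (simp add: field_simps)
  moreover have "(d ^ m / cmod l ^ (m + 1)) * (d / cmod l) ^ k = d ^ (k + m) / cmod l ^ (k + m + 1)" for k
    by (simp add: power_add power_divide field_simps)
  ultimately show ?thesis by (simp only:)
qed

lemma neumann_bound_eq:
  "0 \<le> d \<Longrightarrow> d < cmod l \<Longrightarrow> neumann_bound d m l = d ^ m / (cmod l ^ m * (cmod l - d))"
  unfolding neumann_bound_def using neumann_bound_sums by (rule sums_unique[symmetric])

lemma neumann_bound_summable:
  "0 \<le> d \<Longrightarrow> d < cmod l \<Longrightarrow> summable (\<lambda>k. d ^ (k + m) / cmod l ^ (k + m + 1))"
  using neumann_bound_sums sums_summable by blast

context
  fixes l :: complex
  assumes l: "real CARD('d::finite) < cmod l"
begin

lemma spectral_parameter_nonzero: "l \<noteq> 0"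
  using l by auto

lemma l1_le_neumann_term:
  fixes f :: "int ^ 'd \<Rightarrow> complex"
  assumes "l1_le f C"
  shows "l1_le (\<lambda>n. - (laplacian ^^ k) f n / l ^ j) (real CARD('d) ^ k / cmod l ^ j * C)"
  using l1_le_cmult[OF l1_le_laplacian_power[OF assms, of k], of "- 1 / l ^ j"]
  by (simp add: norm_divide norm_power)

lemma neumann_summable:
  fixes f :: "int ^ 'd \<Rightarrow> complex"
  assumes "l1_le f C"
  shows "summable (\<lambda>k. - (laplacian ^^ (k + m)) f n / l ^ (k + m + 1))"
  by (rule l1_le_suminf(2)[OF l1_le_neumann_term[OF assms]])
    (intro summable_mult2 neumann_bound_summable, use l in auto)

lemma l1_le_neumann:
  fixes f :: "int ^ 'd \<Rightarrow> complex"
  assumes "l1_le f C"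
  shows "l1_le (neumann m l f) (neumann_bound (real CARD('d)) m l * C)"
proof -
  have s: "summable (\<lambda>k. real CARD('d) ^ (k + m) / cmod l ^ (k + m + 1))"
    using l by (intro neumann_bound_summable) auto
  show ?thesis
    using l1_le_suminf(1)[OF l1_le_neumann_term[OF assms] summable_mult2[OF s]]
    by (simp only: neumann_def[abs_def] neumann_bound_def suminf_mult2[OF s])
qed

lemma neumann_0:
  fixes f :: "int ^ 'd \<Rightarrow> complex"
  assumes "l1_le f C"
  shows "neumann 0 l f n = - f n / l + neumann 1 l f n"
  using suminf_split_head[OF neumann_summable[OF assms, of 0 n]] by (simp add: neumann_def)

text \<open>The Laplacian shifts the series by one term. Together with \<open>neumann_0\<close> this
  makes Laplacian - l telescope to the identity on the full series.\<close>

lemma laplacian_neumann: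
  fixes f :: "int ^ 'd \<Rightarrow> complex"
  assumes "l1_le f C"
  shows "laplacian (neumann 0 l f) n = l * neumann 1 l f n"
proof -
  note s = neumann_summable[OF assms]
  have "laplacian (neumann 0 l f) n
      = 1 / 2 * (\<Sum>k. \<Sum>e\<in>unit_steps. - (laplacian ^^ (k + 0)) f (n - e) / l ^ (k + 0 + 1))"
    unfolding laplacian_eq[of "neumann 0 l f"] neumann_def by (subst suminf_sum[OF s]) (rule refl)
  also have "\<dots> = (\<Sum>k. 1 / 2 * (\<Sum>e\<in>unit_steps. - (laplacian ^^ (k + 0)) f (n - e) / l ^ (k + 0 + 1)))"
    by (intro suminf_mult[symmetric] summable_sum s)
  also have "\<dots> = (\<Sum>k. l * (- (laplacian ^^ (k + 1)) f n / l ^ (k + 1 + 1)))"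
  proof (rule suminf_cong)
    fix k
    have "(\<Sum>e\<in>unit_steps. - (laplacian ^^ (k + 0)) f (n - e) / l ^ (k + 0 + 1))
        = - (\<Sum>e\<in>unit_steps. (laplacian ^^ k) f (n - e)) / l ^ (k + 1)"
      by (simp add: sum_divide_distrib sum_negf)
    then show "1 / 2 * (\<Sum>e\<in>unit_steps. - (laplacian ^^ (k + 0)) f (n - e) / l ^ (k + 0 + 1))
        = l * (- (laplacian ^^ (k + 1)) f n / l ^ (k + 1 + 1))"
      using spectral_parameter_nonzero by (simp add: laplacian_eq[of "(laplacian ^^ k) f"])
  qed
  also have "\<dots> = l * neumann 1 l f n"
    unfolding neumann_def by (rule suminf_mult[OF s])
  finally show ?thesis .
qed

text \<open>Since \<open>R0\<close> is an \<open>inv_into\<close>, a preimage determines its value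
  only together with injectivity on \<open>ell2\<close>. Elements of \<open>ell2\<close> are
  bounded, and a bounded solution of the eigenvalue equation with |l| > d vanishes, because the
  Laplacian has norm at most d in the supremum norm.\<close>

lemma R0_eq_neumann:
  fixes f :: "int ^ 'd \<Rightarrow> complex"
  assumes f: "l1_le f C"
  shows "R0 l f = neumann 0 l f"
  unfolding R0_def
proof (rule inv_into_f_eq)
  show "neumann 0 l f \<in> ell2" by (rule l1_le_imp_ell2[OF l1_le_neumann[OF f]])
  show "(\<lambda>n. laplacian (neumann 0 l f) n - l * neumann 0 l f n) = f"
    using laplacian_neumann[OF f] neumann_0[OF f] spectral_parameter_nonzero by (auto simp: field_simps)
  show "inj_on (\<lambda>g n. laplacian g n - l * g n) (ell2 :: (int ^ 'd \<Rightarrow> complex) set)"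
  proof (rule inj_onI)
    fix g h :: "int ^ 'd \<Rightarrow> complex"
    assume gh: "g \<in> ell2" "h \<in> ell2"
      and eq: "(\<lambda>n. laplacian g n - l * g n) = (\<lambda>n. laplacian h n - l * h n)"
    have bd: "\<exists>B. \<forall>n. cmod (u n) \<le> B" if "u \<in> ell2" for u :: "int ^ 'd \<Rightarrow> complex"
    proof (intro exI allI)
      fix n
      have "(cmod (u n))\<^sup>2 \<le> (\<Sum>\<^sub>\<infinity>n. (cmod (u n))\<^sup>2)"
        using that finite_sum_le_infsum[of "\<lambda>n. (cmod (u n))\<^sup>2" UNIV "{n}"]
        by (simp add: ell2_def)
      then show "cmod (u n) \<le> sqrt (\<Sum>\<^sub>\<infinity>n. (cmod (u n))\<^sup>2)" by (rule real_le_rsqrt)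
    qed
    obtain Bg Bh where B: "\<And>n. cmod (g n) \<le> Bg" "\<And>n. cmod (h n) \<le> Bh"
      using bd gh by metis
    define u where "u n = g n - h n" for n
    define b where "b = Bg + Bh"
    have b0: "b \<ge> 0" using B[of undefined] norm_ge_zero order_trans unfolding b_def by (metis add_nonneg_nonneg)
    have eig: "laplacian u n = l * u n" for n
      using fun_cong[OF eq, of n] unfolding u_def laplacian_eq
      by (simp add: sum_subtractf algebra_simps) (simp add: field_simps)
    \<comment> \<open>Each use of the eigenvalue equation improves the uniform bound by the factor
      d/|l| < 1.\<close>
    have "cmod (u n) \<le> b * (real CARD('d) / cmod l) ^ k" for n k
    proof (induction k arbitrary: n)
      case 0 show ?case
        using B[of n] norm_triangle_ineq4[of "g n" "h n"] by (auto simp: u_def b_def)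
    next
      case (Suc k)
      have "cmod l * cmod (u n) \<le> abs_laplacian (\<lambda>n. cmod (u n)) n"
        using cmod_laplacian_le[of u n] by (simp add: eig norm_mult)
      also have "\<dots> \<le> 1 / 2 * (\<Sum>e\<in>(unit_steps :: (int ^ 'd) set). b * (real CARD('d) / cmod l) ^ k)"
        unfolding abs_laplacian_def by (intro mult_left_mono sum_mono Suc.IH) auto
      also have "\<dots> \<le> real CARD('d) * (b * (real CARD('d) / cmod l) ^ k)"
        using half_card_unit_steps[of "b * (real CARD('d) / cmod l) ^ k", where 'd = 'd] b0
        by simp
      finally show ?case using spectral_parameter_nonzero by (simp add: field_simps)
    qed
    moreover have "(\<lambda>k. b * (real CARD('d) / cmod l) ^ k) \<longlonglongrightarrow> 0"
      using l spectral_parameter_nonzero by (intro tendsto_mult_right_zero LIMSEQ_power_zero) (auto simp: divide_less_eq)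
    ultimately have "cmod (u n) \<le> 0" for n
      by (intro LIMSEQ_le_const[of "\<lambda>k. b * (real CARD('d) / cmod l) ^ k"]) auto
    then show "g = h" by (auto simp: u_def fun_eq_iff)
  qed
qed

lemma neumann_linear:
  fixes f g :: "int ^ 'd \<Rightarrow> complex"
  assumes "l1_le f C" "l1_le g D"
  shows "neumann m l (\<lambda>n. f n + c * g n) n = neumann m l f n + c * neumann m l g n"
proof -
  note s = neumann_summable[OF assms(1)] neumann_summable[OF assms(2)]
  have "neumann m l f n + c * neumann m l g n
    = (\<Sum>k. - (laplacian ^^ (k + m)) f n / l ^ (k + m + 1)
          + c * (- (laplacian ^^ (k + m)) g n / l ^ (k + m + 1)))"
    unfolding neumann_def
    by (simp only: suminf_add[OF s(1) summable_mult[OF s(2)], symmetric] suminf_mult[OF s(2), symmetric])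
  also have "\<dots> = neumann m l (\<lambda>n. f n + c * g n) n"
    unfolding neumann_def laplacian_power_linear
    by (intro suminf_cong) (simp add: diff_divide_distrib)
  finally show ?thesis by simp
qed

text \<open>The version of \<open>sum_laplacian_power_le\<close> for the whole series. The column
  bounds \<open>C j\<close> secure convergence for each \<open>j\<close>; the estimate itself
  depends only on the row sums \<open>h\<close>, and so is uniform in the finite set
  \<open>G\<close>.\<close>

lemma neumann_row_bound:
  fixes u :: "'j \<Rightarrow> int ^ 'd \<Rightarrow> complex"
  assumes "finite G" and u: "\<And>j. l1_le (u j) (C j)" and h: "\<And>i. (\<Sum>j\<in>G. cmod (u j i)) \<le> h i"
    and s: "summable (\<lambda>k. (abs_laplacian ^^ (k + m)) h i / cmod l ^ (k + m + 1))"
  shows "(\<Sum>j\<in>G. cmod (neumann m l (u j) i))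
    \<le> (\<Sum>k. (abs_laplacian ^^ (k + m)) h i / cmod l ^ (k + m + 1))"
proof -
  have sn: "summable (\<lambda>k. cmod (- (laplacian ^^ (k + m)) (u j) i / l ^ (k + m + 1)))" for j
  proof (rule summable_comparison_test')
    show "summable (\<lambda>k. real CARD('d) ^ (k + m) / cmod l ^ (k + m + 1) * C j)"
      using l by (intro summable_mult2 neumann_bound_summable) auto
    show "norm (cmod (- (laplacian ^^ (k + m)) (u j) i / l ^ (k + m + 1)))
      \<le> real CARD('d) ^ (k + m) / cmod l ^ (k + m + 1) * C j" for k
      unfolding real_norm_def abs_norm_cancel by (rule l1_le_point[OF l1_le_neumann_term[OF u]])
  qed
  have "(\<Sum>j\<in>G. cmod (neumann m l (u j) i))
      \<le> (\<Sum>j\<in>G. \<Sum>k. cmod (- (laplacian ^^ (k + m)) (u j) i / l ^ (k + m + 1)))"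
    unfolding neumann_def by (intro sum_mono summable_norm sn)
  also have "\<dots> = (\<Sum>k. \<Sum>j\<in>G. cmod (- (laplacian ^^ (k + m)) (u j) i / l ^ (k + m + 1)))"
    by (rule suminf_sum[symmetric]) (rule sn)
  also have "\<dots> \<le> (\<Sum>k. (abs_laplacian ^^ (k + m)) h i / cmod l ^ (k + m + 1))"
  proof (intro suminf_le summable_sum sn s)
    fix k
    have "(\<Sum>j\<in>G. cmod (- (laplacian ^^ (k + m)) (u j) i / l ^ (k + m + 1)))
      = (\<Sum>j\<in>G. cmod ((laplacian ^^ (k + m)) (u j) i)) / cmod l ^ (k + m + 1)"
      by (simp add: norm_divide norm_power sum_divide_distrib norm_mult)
    also have "\<dots> \<le> (abs_laplacian ^^ (k + m)) h i / cmod l ^ (k + m + 1)"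
      by (intro divide_right_mono sum_laplacian_power_le h) auto
    finally show "(\<Sum>j\<in>G. cmod (- (laplacian ^^ (k + m)) (u j) i / l ^ (k + m + 1)))
      \<le> (abs_laplacian ^^ (k + m)) h i / cmod l ^ (k + m + 1)" .
  qed
  finally show ?thesis .
qed

end

subsection \<open>Fredholm determinants with summable columns\<close>

lemma abs_summable_of_finite_sums:
  fixes f :: "'a \<Rightarrow> 'b::banach"
  assumes "\<And>F. finite F \<Longrightarrow> F \<subseteq> A \<Longrightarrow> (\<Sum>x\<in>F. norm (f x)) \<le> C"
  shows "f abs_summable_on A" "f summable_on A" "(\<Sum>\<^sub>\<infinity>x\<in>A. norm (f x)) \<le> C" "norm (infsum f A) \<le> C"
proof -
  show 1: "f abs_summable_on A"
    by (intro nonneg_bdd_above_summable_on bdd_aboveI2[where M = C]) (use assms in auto)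
  then show "f summable_on A" by (rule abs_summable_summable)
  show 2: "(\<Sum>\<^sub>\<infinity>x\<in>A. norm (f x)) \<le> C" by (rule infsum_le_finite_sums[OF 1 assms])
  show "norm (infsum f A) \<le> C"
    using norm_infsum_bound[OF 1] 2 by linarith
qed

lemma has_sum_finite_sum:
  fixes f :: "'b \<Rightarrow> 'a \<Rightarrow> real"
  assumes "finite G" "\<And>j. f j summable_on A"
  shows "((\<lambda>x. \<Sum>j\<in>G. f j x) has_sum (\<Sum>j\<in>G. infsum (f j) A)) A"
  using assms(1)
proof (induction G rule: finite_induct)
  case (insert j G)
  then show ?case using has_sum_add[OF has_sum_infsum[OF assms(2), of j] insert.IH] by simp
qed simp

text \<open>Expanding the product of the column sums gives one term for each self-map of \<open>S\<close>; the
  permutations are among these.\<close>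

lemma sum_signed_permutations_le:
  fixes t :: "'a \<Rightarrow> 'a \<Rightarrow> complex"
  assumes S: "finite S" and c: "\<And>j. j \<in> S \<Longrightarrow> (\<Sum>i\<in>S. cmod (t i j)) \<le> c j"
  shows "cmod (\<Sum>s | s permutes S. of_int (sign s) * (\<Prod>i\<in>S. t i (s i))) \<le> (\<Prod>j\<in>S. c j)"
proof -
  have "cmod (\<Sum>s | s permutes S. of_int (sign s) * (\<Prod>i\<in>S. t i (s i)))
      \<le> (\<Sum>s | s permutes S. \<Prod>i\<in>S. cmod (t i (s i)))"
    by (intro sum_norm_le) (auto simp: norm_mult sign_def prod_norm)
  \<comment> \<open>The products run over rows, one entry \<open>t i (s i)\<close> per row
    \<open>i\<close>. Passing to inverse permutations indexes them by columns, where the bounds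
    \<open>c j\<close> apply.\<close>
  also have "\<dots> = (\<Sum>s | s permutes S. \<Prod>i\<in>S. cmod (t i (inv s i)))"
    by (rule sum_permutations_inverse)
  also have "\<dots> = (\<Sum>s | s permutes S. \<Prod>j\<in>S. cmod (t (s j) j))"
  proof (intro sum.cong refl)
    fix s assume "s \<in> {s. s permutes S}"
    then have s: "s permutes S" by simp
    show "(\<Prod>i\<in>S. cmod (t i (inv s i))) = (\<Prod>j\<in>S. cmod (t (s j) j))"
      by (subst prod.permute[OF s]) (simp add: o_def permutes_inverses[OF s])
  qed
  also have "\<dots> = (\<Sum>g\<in>(\<lambda>s. restrict s S) ` {s. s permutes S}. \<Prod>j\<in>S. cmod (t (g j) j))"
  proof (subst sum.reindex)
    show "inj_on (\<lambda>s. restrict s S) {s. s permutes S}"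
    proof (rule inj_onI, rule ext)
      fix s s' x
      assume "s \<in> {s. s permutes S}" "s' \<in> {s. s permutes S}" "restrict s S = restrict s' S"
      then show "s x = s' x"
        by (cases "x \<in> S") (auto simp: permutes_not_in dest: fun_cong[of _ _ x])
    qed
  qed (auto intro!: sum.cong prod.cong)
  also have "\<dots> \<le> (\<Sum>g\<in>PiE S (\<lambda>_. S). \<Prod>j\<in>S. cmod (t (g j) j))"
    using S by (intro sum_mono2 finite_PiE) (auto simp: permutes_in_image intro!: prod_nonneg)
  also have "\<dots> = (\<Prod>j\<in>S. \<Sum>i\<in>S. cmod (t i j))"
    using S by (intro prod_sum_PiE[symmetric])
  also have "\<dots> \<le> (\<Prod>j\<in>S. c j)"
    using c by (intro prod_mono) (auto intro!: sum_nonneg)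
  finally show ?thesis .
qed

text \<open>Multiplying out the product of the factors 1 + c_j yields all subset products at once,
  and it is at most the exponential of the sum of the c_j. For sets with at least two elements, the
  empty set and the singletons are subtracted; they account for 1 + x in exp x <= 1 + x + x^2, valid
  for 0 <= x <= 1.\<close>

lemma sum_subset_products_le:
  fixes c :: "'a \<Rightarrow> real"
  assumes c0: "\<And>j. 0 \<le> c j" and c: "\<And>G. finite G \<Longrightarrow> sum c G \<le> C"
    and \<S>: "finite \<S>" "\<And>S. S \<in> \<S> \<Longrightarrow> finite S"
  shows "(\<Sum>S\<in>\<S>. \<Prod>j\<in>S. c j) \<le> exp C"
    and "C \<le> 1 \<Longrightarrow> (\<And>S. S \<in> \<S> \<Longrightarrow> 2 \<le> card S) \<Longrightarrow> (\<Sum>S\<in>\<S>. \<Prod>j\<in>S. c j) \<le> C\<^sup>2"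
proof -
  define F where "F = \<Union>\<S>"
  have F: "finite F" using \<S> by (auto simp: F_def)
  have sub: "\<S> \<subseteq> Pow F" by (auto simp: F_def)
  have nn: "0 \<le> (\<Prod>j\<in>S. c j)" for S by (intro prod_nonneg) (use c0 in auto)
  have "(\<Sum>S\<in>Pow F. \<Prod>j\<in>S. c j) = (\<Prod>j\<in>F. c j + 1)"
    using prod_add[OF F, of c "\<lambda>_. 1"] by simp
  also have "\<dots> \<le> exp (sum c F)"
    using prod_le_exp_sum[of F c] c0 by (simp add: add.commute)
  finally have le: "(\<Sum>S\<in>Pow F. \<Prod>j\<in>S. c j) \<le> exp (sum c F)" .
  have "(\<Sum>S\<in>\<S>. \<Prod>j\<in>S. c j) \<le> (\<Sum>S\<in>Pow F. \<Prod>j\<in>S. c j)"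
    using sub F nn by (intro sum_mono2) auto
  also note le
  also have "exp (sum c F) \<le> exp C" using c[OF F] by simp
  finally show "(\<Sum>S\<in>\<S>. \<Prod>j\<in>S. c j) \<le> exp C" .
  assume C: "C \<le> 1" and card: "\<And>S. S \<in> \<S> \<Longrightarrow> 2 \<le> card S"
  let ?T = "insert {} ((\<lambda>j. {j}) ` F)"
  have dis: "\<S> \<inter> ?T = {}" using card by force
  have "(\<Sum>S\<in>\<S>. \<Prod>j\<in>S. c j) + (1 + sum c F) = (\<Sum>S\<in>\<S> \<union> ?T. \<Prod>j\<in>S. c j)"
  proof -
    have "{} \<notin> (\<lambda>j. {j}) ` F" by auto
    then have "(\<Sum>S\<in>?T. \<Prod>j\<in>S. c j) = 1 + sum c F"
      using F by (simp add: sum.reindex inj_on_def)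
    then show ?thesis using F \<S> dis by (subst sum.union_disjoint) auto
  qed
  also have "\<dots> \<le> (\<Sum>S\<in>Pow F. \<Prod>j\<in>S. c j)"
    using sub F nn by (intro sum_mono2) auto
  also note le
  also have "exp (sum c F) \<le> 1 + sum c F + (sum c F)\<^sup>2"
    using c[OF F] C c0 by (intro exp_bound) (auto intro!: sum_nonneg)
  finally have "(\<Sum>S\<in>\<S>. \<Prod>j\<in>S. c j) \<le> (sum c F)\<^sup>2" by simp
  also have "\<dots> \<le> C\<^sup>2" using c[OF F] c0 by (intro power_mono) (auto intro!: sum_nonneg)
  finally show "(\<Sum>S\<in>\<S>. \<Prod>j\<in>S. c j) \<le> C\<^sup>2" .
qed

text \<open>In the expansion by principal minors the empty set contributes 1 and the singletons the
  trace of M - I; minors of size at least 2 are quadratic in the column norms.\<close>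

lemma op_det_approx:
  fixes M :: "'a operator"
  assumes col: "\<And>j. l1_le (\<lambda>i. M (delta j) i - delta j i) (c j)"
    and c: "\<And>G. finite G \<Longrightarrow> sum c G \<le> C" and C: "C \<le> 1"
  shows "cmod (op_det M - (1 + (\<Sum>\<^sub>\<infinity>j. M (delta j) j - delta j j))) \<le> C\<^sup>2"
proof -
  define t where "t i j = M (delta j) i - delta j i" for i j
  define m where "m S = (\<Sum>s | s permutes S. of_int (sign s) * (\<Prod>i\<in>S. t i (s i)))" for S
  have c0: "0 \<le> c j" for j using l1_le_nonneg[OF col] .
  have m: "cmod (m S) \<le> (\<Prod>j\<in>S. c j)" if "finite S" for S
    unfolding m_def using that l1_leD[OF col]
    by (intro sum_signed_permutations_le) (auto simp: t_def)
  \<comment> \<open>This crude bound gives summability over all finite sets, which allows splitting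
    the sum by cardinality; \<open>le2\<close> then measures the remainder.\<close>
  have le: "(\<Sum>S\<in>\<S>. cmod (m S)) \<le> exp C" if "finite \<S>" "\<S> \<subseteq> {S. finite S}" for \<S>
  proof -
    have "(\<Sum>S\<in>\<S>. cmod (m S)) \<le> (\<Sum>S\<in>\<S>. \<Prod>j\<in>S. c j)"
      using that m by (intro sum_mono) auto
    then show ?thesis
      using sum_subset_products_le(1)[of c C \<S>, OF c0 c that(1)] that by fastforce
  qed
  have le2: "(\<Sum>S\<in>\<S>. cmod (m S)) \<le> C\<^sup>2" if "finite \<S>" "\<S> \<subseteq> {S. finite S \<and> 2 \<le> card S}" for \<S>
  proof -
    have "(\<Sum>S\<in>\<S>. cmod (m S)) \<le> (\<Sum>S\<in>\<S>. \<Prod>j\<in>S. c j)"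
      using that m by (intro sum_mono) auto
    then show ?thesis
      using sum_subset_products_le(2)[of c C \<S>, OF c0 c that(1)] that C by fastforce
  qed
  have summ: "m summable_on {S. finite S}"
    by (rule abs_summable_of_finite_sums(2)[OF le])
  have eq: "{S :: 'a set. finite S} = (insert {} (range (\<lambda>j. {j}))) \<union> {S. finite S \<and> 2 \<le> card S}"
  proof -
    have "S = {} \<or> (\<exists>j. S = {j}) \<or> 2 \<le> card S" if "finite S" for S :: "'a set"
    proof (cases "card S = 0 \<or> card S = 1")
      case True
      then show ?thesis using that by (auto simp: card_1_singleton_iff)
    next
      case False
      then have "2 \<le> card S" by linarith
      then show ?thesis by simp
    qed
    then show ?thesis by auto
  qed
  have sub: "m summable_on T" if "T \<subseteq> {S. finite S}" for T
    by (rule summable_on_subset_banach[OF summ that])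
  have "op_det M = infsum m {S. finite S}"
    by (simp add: op_det_def m_def[abs_def] t_def)
  also have "\<dots> = infsum m (insert {} (range (\<lambda>j. {j}))) + infsum m {S. finite S \<and> 2 \<le> card S}"
    unfolding eq by (rule infsum_Un_disjoint) (auto intro!: sub)
  also have "infsum m (insert {} (range (\<lambda>j. {j}))) = infsum m {{}} + infsum m (range (\<lambda>j. {j}))"
    unfolding insert_is_Un[of "{}" "range _"] by (rule infsum_Un_disjoint) (auto intro!: sub)
  also have "infsum m {{}} = 1" by (simp add: m_def)
  also have "infsum m (range (\<lambda>j. {j})) = (\<Sum>\<^sub>\<infinity>j. M (delta j) j - delta j j)"
    by (subst infsum_reindex) (auto simp: o_def m_def t_def inj_on_def)
  finally have "op_det M - (1 + (\<Sum>\<^sub>\<infinity>j. M (delta j) j - delta j j))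
      = infsum m {S. finite S \<and> 2 \<le> card S}" by simp
  then show ?thesis
    using abs_summable_of_finite_sums(4)[OF le2] by simp
qed

text \<open>What the exponential estimate uses of V R0(l) for large l. Linearity is required on
  summable functions, where \<open>R0\<close> is known to be the Neumann series. The threshold 1/2
  gives geometric series of ratio 1/2.\<close>

locale l1_contraction =
  fixes A :: "'a operator" and a :: real
  assumes a: "0 \<le> a" "a \<le> 1 / 2"
    and bound: "l1_le f C \<Longrightarrow> l1_le (A f) (a * C)"
    and lin: "l1_le f C \<Longrightarrow> l1_le g D \<Longrightarrow> A (\<lambda>n. f n + c * g n) n = A f n + c * A g n"
begin

lemma l1_le_power: "l1_le f C \<Longrightarrow> l1_le ((A ^^ k) f) (a ^ k * C)"
  by (induction k) (auto dest: bound simp: mult.assoc)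

lemma scale: "l1_le f C \<Longrightarrow> A (\<lambda>n. c * f n) n = c * A f n"
proof -
  assume f: "l1_le f C"
  have z: "l1_le (\<lambda>n::'a. 0 :: complex) 0" by (simp add: l1_le_def)
  have "A (\<lambda>n. 0) n = 0" using lin[OF z z, of 1 n] by simp
  then show ?thesis using lin[OF z f, of c n] by simp
qed

lemma uminus_power: "l1_le f C \<Longrightarrow> ((\<lambda>h n. - A h n) ^^ k) f = (\<lambda>n. (-1) ^ k * (A ^^ k) f n)"
proof (induction k)
  case (Suc k)
  then have "((\<lambda>h n. - A h n) ^^ k) f = (\<lambda>n. (-1) ^ k * (A ^^ k) f n)" by blast
  then show ?case using scale[OF l1_le_power[OF Suc.prems, of k]] by auto
qed simp

text \<open>The error is measured by \<open>A\<^sup>2 f\<close> rather than by \<open>f\<close>: over the standard basis only the norms of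
  \<open>A\<^sup>2 \<delta>\<^sub>j\<close> are summable when \<open>V\<close> is merely square summable.\<close>

lemma regularized_approx:
  assumes f: "l1_le f C" and D: "l1_le ((A ^^ 2) f) D"
  defines "E \<equiv> op_exp (\<lambda>h n. - A h n) f"
  shows "l1_le (\<lambda>n. E n + A E n - f n + 1 / 2 * (A ^^ 2) f n) (2 * a * D)"
proof -
  define u where "u k n = (-1) ^ k * (A ^^ k) f n / fact k" for k n
  define r where "r n = (\<Sum>k. u (k + 3) n)" for n
  have D0: "0 \<le> D" using l1_le_nonneg[OF D] .
  have C0: "0 \<le> C" using l1_le_nonneg[OF f] .
  have u: "l1_le (u k) ((1 / 2) ^ k * C)" for k
  proof -
    have "l1_le (u k) (cmod ((-1) ^ k / fact k) * (a ^ k * C))"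
      using l1_le_cmult[OF l1_le_power[OF f, of k], of "(-1) ^ k / fact k"] by (simp add: u_def[abs_def])
    moreover have "cmod ((-1) ^ k / fact k) * (a ^ k * C) \<le> 1 * ((1 / 2) ^ k * C)"
      using a C0 by (intro mult_mono power_mono) (auto simp: norm_divide norm_power fact_ge_1)
    ultimately show ?thesis by (auto intro: l1_le_mono)
  qed
  have su: "summable (\<lambda>k. u k n)" for n
    by (rule l1_le_suminf(2)[OF u]) (intro summable_mult2 summable_geometric, simp)
  \<comment> \<open>In (I + A)(I - A + A^2/2) = I - A^2/2 + A^3/2 the first-order terms cancel. The
    error therefore consists of A^3 f / 2, r and A r.\<close>
  have E: "E n = f n + (-1) * A f n + 1 / 2 * (A ^^ 2) f n + r n" for n
    using suminf_split_initial_segment[OF su, of n 3] uminus_power[OF f]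
    by (simp add: E_def op_exp_def u_def r_def numeral_3_eq_3 power2_eq_square numeral_2_eq_2 algebra_simps)
  \<comment> \<open>Two of the \<open>k + 3\<close> powers of A are spent on \<open>D\<close>, and
    one of the others is kept as the factor \<open>a\<close>. The remaining a^k and the factorial,
    at least 2, leave (1/2)^(k+1), whose sum is 1.\<close>
  have ut: "l1_le (u (k + 3)) (a * D * (1 / 2) ^ Suc k)" for k
  proof -
    have "l1_le (u (k + 3)) (cmod ((-1) ^ (k + 3) / fact (k + 3)) * (a ^ (k + 1) * D))"
      using l1_le_cmult[OF l1_le_power[OF D, of "k + 1"], of "(-1) ^ (k + 3) / fact (k + 3)"]
      by (simp add: u_def[abs_def] flip: funpow_add comp_apply[of "A ^^ _" "A ^^ _"])
        (simp add: numeral_3_eq_3 numeral_2_eq_2 funpow_swap1)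
    moreover have "cmod ((-1) ^ (k + 3) / fact (k + 3)) * (a ^ (k + 1) * D)
      \<le> 1 / 2 * ((1 / 2) ^ k * a * D)"
    proof (intro mult_mono)
      have "(2::real) \<le> fact (k + 3)"
        using fact_mono[of 2 "k + 3", where 'a = real] by (simp add: numeral_2_eq_2)
      then show "cmod ((-1) ^ (k + 3) / fact (k + 3)) \<le> 1 / 2"
        by (simp add: norm_divide norm_power divide_simps del: fact_Suc)
      have "a ^ k \<le> (1 / 2) ^ k" using a by (intro power_mono) auto
      then show "a ^ (k + 1) \<le> (1 / 2) ^ k * a" using a by (simp add: mult.commute mult_left_mono)
    qed (use a D0 in auto)
    ultimately show ?thesis by (rule l1_le_mono[OF _ order_trans]) simp
  qed
  have r: "l1_le r (a * D)"
  proof -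
    have "(\<lambda>k. a * D * (1 / 2) ^ Suc k) sums (a * D * 1)"
      by (rule sums_mult[OF power_half_series])
    then have s: "summable (\<lambda>k. a * D * (1 / 2) ^ Suc k)" "(\<Sum>k. a * D * (1 / 2) ^ Suc k) = a * D"
      by (simp_all only: sums_iff mult_1_right)
    show ?thesis using l1_le_suminf(1)[OF ut s(1)] unfolding s(2) r_def[abs_def] .
  qed
  have f1: "l1_le (A f) (a * C)" by (rule bound[OF f])
  have f3: "l1_le (A ((A ^^ 2) f)) (a * D)" by (rule bound[OF D])
  have s1: "l1_le (\<lambda>n. f n + (-1) * A f n) (C + cmod (-1) * (a * C))"
    by (intro l1_le_add l1_le_cmult f f1)
  have s2: "l1_le (\<lambda>n. f n + (-1) * A f n + 1 / 2 * (A ^^ 2) f n) (C + cmod (-1) * (a * C) + cmod (1 / 2) * D)"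
    by (intro l1_le_add[OF s1] l1_le_cmult D)
  have "A E n = A (\<lambda>n. (f n + (-1) * A f n + 1 / 2 * (A ^^ 2) f n) + 1 * r n) n" for n
    by (simp add: E[abs_def])
  then have AE: "A E n = A f n - (A ^^ 2) f n + 1 / 2 * A ((A ^^ 2) f) n + A r n" for n
    using lin[OF s2 r, of 1 n] lin[OF s1 D, of "1 / 2" n] lin[OF f f1, of "-1" n]
    by (simp add: numeral_2_eq_2)
  have "l1_le (\<lambda>n. r n + 1 / 2 * A ((A ^^ 2) f) n + A r n) (a * D + cmod (1 / 2) * (a * D) + a * (a * D))"
    by (intro l1_le_add l1_le_cmult r f3 bound)
  \<comment> \<open>The constant 2 is 1 + 1/2 + a with a <= 1/2.\<close>
  moreover have "a * D + cmod (1 / 2) * (a * D) + a * (a * D) \<le> 2 * a * D"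
    using mult_right_mono[OF a(2), of "a * D"] a D0 by (simp add: algebra_simps)
  ultimately have "l1_le (\<lambda>n. r n + 1 / 2 * A ((A ^^ 2) f) n + A r n) (2 * a * D)"
    by (rule l1_le_mono)
  then show ?thesis by (simp add: AE E algebra_simps)
qed

end

subsection \<open>The regularized determinant at large spectral parameter\<close>

lemma abs_laplacian_power_mono:
  assumes "\<And>n. 0 \<le> v n" "\<And>n. v n \<le> w n"
  shows "0 \<le> (abs_laplacian ^^ k) v n \<and> (abs_laplacian ^^ k) v n \<le> (abs_laplacian ^^ k) w n"
proof (induction k arbitrary: n)
  case (Suc k)
  then show ?case
    by (simp add: abs_laplacian_def[of "(abs_laplacian ^^ k) _"] sum_nonneg sum_mono)
qed (use assms in auto)

lemma abs_laplacian_power_scale: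
  "(abs_laplacian ^^ k) (\<lambda>n. c * v n) = (\<lambda>n. c * (abs_laplacian ^^ k) v n)"
  by (induction k) (simp_all add: abs_laplacian_def[abs_def] sum_distrib_left mult.left_commute)

context
  fixes V :: "int ^ 'd::finite \<Rightarrow> complex" and l :: complex and S :: real
    and A :: "(int ^ 'd) operator" and K :: "nat \<Rightarrow> real"
  assumes l: "real CARD('d) < cmod l"
    and S: "\<And>F. finite F \<Longrightarrow> (\<Sum>n\<in>F. (cmod (V n))\<^sup>2) \<le> S"
    and A_def: "A = mult_op V \<circ> R0 l"
    and K_def: "K = (\<lambda>m. neumann_bound (real CARD('d)) m l)"
begin

lemma l2_bound_nonneg: "0 \<le> S"
  using S[of "{}"] by simp

lemma potential_bounded: "cmod (V n) \<le> sqrt S"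
  using S[of "{n}"] by (intro real_le_rsqrt) simp

lemma neumann_bound_nonneg: "0 \<le> K m"
  using l by (simp add: K_def neumann_bound_eq)

lemma birman_schwinger_eq: "l1_le f C \<Longrightarrow> A f = (\<lambda>n. V n * neumann 0 l f n)"
  by (auto simp: A_def mult_op_def R0_eq_neumann[OF l])

lemma l1_le_birman_schwinger: "l1_le f C \<Longrightarrow> l1_le (A f) (sqrt S * K 0 * C)"
  using l1_le_mult[OF potential_bounded l1_le_neumann[OF l, of f C 0]] by (simp only: birman_schwinger_eq K_def mult.assoc)

lemma birman_schwinger_linear:
  assumes "l1_le f C" "l1_le g D"
  shows "A (\<lambda>n. f n + c * g n) n = A f n + c * A g n"
  using birman_schwinger_eq[OF l1_le_add[OF assms(1) l1_le_cmult[OF assms(2), of c]]] birman_schwinger_eq[OF assms(1)] birman_schwinger_eq[OF assms(2)]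
  by (simp add: neumann_linear[OF l assms] algebra_simps)

text \<open>The columns \<open>delta j\<close> have row sums at most 1, so the row sums of the
  kernel obey the supremum norm bound of the series.\<close>

lemma neumann_delta_row:
  fixes i :: "int ^ 'd"
  assumes "finite G"
  shows "(\<Sum>j\<in>G. cmod (neumann m l (delta j) i)) \<le> K m"
proof -
  let ?t = "\<lambda>k. (abs_laplacian ^^ (k + m)) (\<lambda>_. 1) i / cmod l ^ (k + m + 1)"
  have t: "0 \<le> ?t k" "?t k \<le> real CARD('d) ^ (k + m) / cmod l ^ (k + m + 1)" for k
    using abs_laplacian_power_mono[of "\<lambda>_. 1" "\<lambda>_. 1"] abs_laplacian_power_const[of 1 "k + m" i]
    by (auto intro!: divide_right_mono divide_nonneg_nonneg)
  have sK: "summable (\<lambda>k. real CARD('d) ^ (k + m) / cmod l ^ (k + m + 1))"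
    using l by (intro neumann_bound_summable) auto
  have s: "summable ?t"
    by (rule summable_comparison_test'[OF sK, of 0]) (use t in \<open>simp only: real_norm_def abs_of_nonneg\<close>)
  have "(\<Sum>j\<in>G. cmod (neumann m l (delta j) i)) \<le> (\<Sum>k. ?t k)"
  proof (rule neumann_row_bound[OF l assms l1_le_delta _ s])
    fix i
    have "(\<Sum>j\<in>G. cmod (delta j i)) = (\<Sum>j\<in>G. if j = i then 1 else 0)"
      by (intro sum.cong) (auto simp: delta_def)
    then show "(\<Sum>j\<in>G. cmod (delta j i)) \<le> 1" using assms by simp
  qed
  also have "\<dots> \<le> K m" unfolding K_def neumann_bound_def by (rule suminf_le[OF t(2) s sK])
  finally show ?thesis .
qed

text \<open>The central estimate. Summing over \<open>j\<close> first replaces the columns of A by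
  its row sums, at most K_0 |V|; what is left is the quadratic form of the positive kernel at |V|.
  For \<open>m = 0\<close> this bounds the summed l^1 norms of A^2 \<open>delta j\<close>, for
  \<open>m = 1\<close> a remainder on the diagonal of A^2.\<close>

lemma sum_V_neumann_A_delta:
  assumes "finite F" "finite G"
  shows "(\<Sum>j\<in>G. \<Sum>i\<in>F. cmod (V i) * cmod (neumann m l (A (delta j)) i)) \<le> K m * K 0 * S"
proof -
  let ?v = "\<lambda>n. cmod (V n)"
  define h where "h i = K 0 * cmod (V i)" for i
  let ?t = "\<lambda>i k. (abs_laplacian ^^ (k + m)) h i / cmod l ^ (k + m + 1)"
  have sK: "summable (\<lambda>k. real CARD('d) ^ (k + m) / cmod l ^ (k + m + 1))"
    using l by (intro neumann_bound_summable) auto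
  have h: "(\<Sum>j\<in>G. cmod (A (delta j) i)) \<le> h i" for i
  proof -
    have "(\<Sum>j\<in>G. cmod (A (delta j) i)) = (\<Sum>j\<in>G. cmod (neumann 0 l (delta j) i)) * cmod (V i)"
      by (simp only: birman_schwinger_eq[OF l1_le_delta] norm_mult sum_distrib_right mult.commute[of "cmod (V i)"])
    then show ?thesis using neumann_delta_row[OF assms(2), of 0 i]
      by (simp add: h_def mult_right_mono)
  qed
  \<comment> \<open>Convergence at a single point needs only the crude bound |V| <=
    \<open>sqrt S\<close>; the sharper l^2 bound appears after summation over
    \<open>F\<close>.\<close>
  have s: "summable (?t i)" for i
  proof (rule summable_comparison_test'[of "\<lambda>k. real CARD('d) ^ (k + m) / cmod l ^ (k + m + 1) * (K 0 * sqrt S)" 0])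
    fix k
    have "0 \<le> h i" "h i \<le> K 0 * sqrt S" for i
      using potential_bounded neumann_bound_nonneg by (auto simp: h_def mult_left_mono)
    then have "0 \<le> (abs_laplacian ^^ (k + m)) h i"
        "(abs_laplacian ^^ (k + m)) h i \<le> (abs_laplacian ^^ (k + m)) (\<lambda>_. K 0 * sqrt S) i"
      using abs_laplacian_power_mono[of h "\<lambda>_. K 0 * sqrt S" "k + m" i] by auto
    moreover have "(abs_laplacian ^^ (k + m)) (\<lambda>_. K 0 * sqrt S) i \<le> real CARD('d) ^ (k + m) * (K 0 * sqrt S)"
      using neumann_bound_nonneg l2_bound_nonneg by (intro abs_laplacian_power_const) auto
    ultimately show "norm (?t i k) \<le> real CARD('d) ^ (k + m) / cmod l ^ (k + m + 1) * (K 0 * sqrt S)"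
      by (auto simp: norm_mult intro!: divide_right_mono)
  qed (intro summable_mult2 sK)
  have "(\<Sum>j\<in>G. \<Sum>i\<in>F. ?v i * cmod (neumann m l (A (delta j)) i))
      = (\<Sum>i\<in>F. ?v i * (\<Sum>j\<in>G. cmod (neumann m l (A (delta j)) i)))"
    by (subst sum.swap) (simp add: sum_distrib_left)
  also have "\<dots> \<le> (\<Sum>i\<in>F. ?v i * (\<Sum>k. ?t i k))"
    using l1_le_birman_schwinger[OF l1_le_delta] h s assms(2)
    by (intro sum_mono mult_left_mono neumann_row_bound[OF l]) auto
  also have "\<dots> = (\<Sum>i\<in>F. \<Sum>k. ?v i * ?t i k)"
    by (simp only: suminf_mult[OF s])
  also have "\<dots> = (\<Sum>k. \<Sum>i\<in>F. ?v i * ?t i k)"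
    by (rule suminf_sum[symmetric]) (intro summable_mult s)
  also have "\<dots> \<le> (\<Sum>k. real CARD('d) ^ (k + m) / cmod l ^ (k + m + 1) * (K 0 * S))"
  proof (intro suminf_le summable_sum summable_mult s summable_mult2 sK)
    fix k
    have "(\<Sum>i\<in>F. ?v i * ?t i k)
        = K 0 / cmod l ^ (k + m + 1) * (\<Sum>i\<in>F. ?v i * (abs_laplacian ^^ (k + m)) ?v i)"
      unfolding h_def[abs_def] abs_laplacian_power_scale by (simp add: sum_distrib_left mult_ac)
    also have "\<dots> \<le> K 0 / cmod l ^ (k + m + 1) * (real CARD('d) ^ (k + m) * S)"
      using S assms(1) neumann_bound_nonneg by (intro mult_left_mono sum_mult_abs_laplacian_power_le) auto
    finally show "(\<Sum>i\<in>F. ?v i * ?t i k) \<le> real CARD('d) ^ (k + m) / cmod l ^ (k + m + 1) * (K 0 * S)"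
      by (simp add: mult_ac)
  qed
  also have "\<dots> = K m * (K 0 * S)"
    unfolding K_def[THEN fun_cong, of m] neumann_bound_def by (rule suminf_mult2[OF sK, symmetric])
  finally show ?thesis by (simp add: mult.assoc)
qed

lemma birman_schwinger_square_delta: "(A ^^ 2) (delta j) n = V n * neumann 0 l (A (delta j)) n"
  by (simp only: numeral_2_eq_2 funpow.simps comp_apply[of A] id_apply birman_schwinger_eq[OF l1_le_birman_schwinger[OF l1_le_delta]])

text \<open>The three error sources are, in this order: minors of size at least 2; the diagonal of
  -A^2/2 beyond its leading part -V^2/(2 l^2); the exponential beyond second order. For large l they
  are of orders l^{-4}, l^{-3} and l^{-3}.\<close>

lemma regularized_det_approx:
  assumes a: "sqrt S * K 0 \<le> 1 / 2" and C: "3 / 2 * ((K 0)\<^sup>2 * S) \<le> 1"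
  shows "cmod (Dcal V l - (1 - (\<Sum>\<^sub>\<infinity>n. (V n)\<^sup>2) / (2 * l\<^sup>2)))
    \<le> (3 / 2 * ((K 0)\<^sup>2 * S))\<^sup>2 + (1 / 2 * (S * K 1 / cmod l + K 1 * K 0 * S) + 2 * (sqrt S * K 0) * ((K 0)\<^sup>2 * S))"
proof -
  let ?a = "sqrt S * K 0"
  interpret l1_contraction A ?a
    using l2_bound_nonneg neumann_bound_nonneg a l1_le_birman_schwinger birman_schwinger_linear by unfold_locales auto
  define M where "M = (\<lambda>f. let g = op_exp (\<lambda>h n. - A h n) f in (\<lambda>n. g n + A g n))"
  have Dcal: "Dcal V l = op_det M" by (simp add: Dcal_def reg_det_def M_def A_def)
  \<comment> \<open>The exact norm of each column, since the bound of order |V|_2^2 holds for the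
    sum over \<open>j\<close> and not for a majorant uniform in \<open>j\<close>.\<close>
  define D where "D j = (\<Sum>\<^sub>\<infinity>i. cmod ((A ^^ 2) (delta j) i))" for j
  have A2: "l1_le ((A ^^ 2) (delta j)) (?a ^ 2 * 1)" for j by (rule l1_le_power[OF l1_le_delta])
  have A2s: "(\<lambda>i. cmod ((A ^^ 2) (delta j) i)) summable_on UNIV" for j
    using l1_leD[OF A2] by (rule abs_summable_of_finite_sums(1))
  have D: "l1_le ((A ^^ 2) (delta j)) (D j)" for j
    unfolding l1_le_def D_def using A2s by (auto intro!: finite_sum_le_infsum)
  have D0: "0 \<le> D j" for j by (rule l1_le_nonneg[OF D])
  have sumD: "sum D G \<le> (K 0)\<^sup>2 * S" if G: "finite G" for G
  proof -
    note hs = has_sum_finite_sum[OF G A2s]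
    have "sum D G = (\<Sum>\<^sub>\<infinity>i. \<Sum>j\<in>G. cmod ((A ^^ 2) (delta j) i))"
      unfolding D_def by (rule infsumI[OF hs, symmetric])
    also have "\<dots> \<le> (K 0)\<^sup>2 * S"
    proof (rule infsum_le_finite_sums)
      show "(\<lambda>i. \<Sum>j\<in>G. cmod ((A ^^ 2) (delta j) i)) summable_on UNIV"
        by (rule has_sum_imp_summable[OF hs])
      fix F :: "(int ^ 'd) set" assume "finite F"
      from sum_V_neumann_A_delta[OF this G, of 0]
      show "(\<Sum>i\<in>F. \<Sum>j\<in>G. cmod ((A ^^ 2) (delta j) i)) \<le> (K 0)\<^sup>2 * S"
        by (subst sum.swap) (simp only: birman_schwinger_square_delta norm_mult power2_eq_square)
    qed
    finally show ?thesis .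
  qed
  define q where "q j n = M (delta j) n - delta j n + 1 / 2 * (A ^^ 2) (delta j) n" for j n
  have q: "l1_le (q j) (2 * ?a * D j)" for j
    using regularized_approx[OF l1_le_delta D] by (simp add: q_def[abs_def] M_def Let_def)
  \<comment> \<open>1/2 comes from A^2/2, and at most 1 from the remainder \<open>q\<close>, because
    2 a <= 1.\<close>
  have col: "l1_le (\<lambda>i. M (delta j) i - delta j i) (3 / 2 * D j)" for j
  proof -
    have "l1_le (\<lambda>i. q j i + (- 1 / 2) * (A ^^ 2) (delta j) i) (2 * ?a * D j + cmod (- 1 / 2) * D j)"
      by (intro l1_le_add q l1_le_cmult D)
    moreover have "2 * ?a * D j + cmod (- 1 / 2) * D j \<le> 3 / 2 * D j"
    proof -
      have "2 * ?a * D j \<le> D j"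
        using mult_right_mono[OF assms(1) D0, of j] by linarith
      moreover have "cmod (- 1 / 2) = 1 / 2" by (simp add: norm_divide)
      then have "cmod (- 1 / 2) * D j = 1 / 2 * D j" by (simp only:)
      ultimately show ?thesis by linarith
    qed
    ultimately have "l1_le (\<lambda>i. q j i + (- 1 / 2) * (A ^^ 2) (delta j) i) (3 / 2 * D j)"
      by (rule l1_le_mono)
    then show ?thesis by (simp add: q_def)
  qed
  have "sum (\<lambda>j. 3 / 2 * D j) G \<le> 3 / 2 * ((K 0)\<^sup>2 * S)" if "finite G" for G
    using sumD[OF that] unfolding sum_distrib_left[symmetric] by simp
  note det = op_det_approx[OF col this C]
  define e where "e j = M (delta j) j - delta j j + 1 / (2 * l\<^sup>2) * (V j)\<^sup>2" for j
  \<comment> \<open>The diagonal entry of A^2 contains two resolvents. Taking -1/l from both gives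
    V_j^2 / l^2, which cancels in \<open>e\<close>; each remaining term carries a tail
    \<open>neumann 1\<close>.\<close>
  have e_eq: "e j = - 1 / 2 * (- (V j)\<^sup>2 / l * neumann 1 l (delta j) j + V j * neumann 1 l (A (delta j)) j) + q j j" for j
  proof -
    have "(A ^^ 2) (delta j) j = V j * (- (V j * (- 1 / l + neumann 1 l (delta j) j)) / l + neumann 1 l (A (delta j)) j)"
      unfolding birman_schwinger_square_delta neumann_0[OF l l1_le_birman_schwinger[OF l1_le_delta]]
      by (simp add: birman_schwinger_eq[OF l1_le_delta] neumann_0[OF l l1_le_delta] del: comp_apply) (simp add: delta_def)
    moreover have "e j = q j j - 1 / 2 * (A ^^ 2) (delta j) j + 1 / (2 * l\<^sup>2) * (V j)\<^sup>2"
      by (simp add: e_def q_def)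
    ultimately have "e j = q j j - 1 / 2 * (V j * (- (V j * (- 1 / l + neumann 1 l (delta j) j)) / l
        + neumann 1 l (A (delta j)) j)) + 1 / (2 * l\<^sup>2) * (V j)\<^sup>2"
      by (simp only:)
    also have "\<dots> = - 1 / 2 * (- (V j)\<^sup>2 / l * neumann 1 l (delta j) j + V j * neumann 1 l (A (delta j)) j) + q j j"
      using spectral_parameter_nonzero[OF l] by (simp add: field_simps power2_eq_square)
    finally show ?thesis .
  qed
  have e: "cmod (e j) \<le> 1 / 2 * ((cmod (V j))\<^sup>2 * (K 1 / cmod l) + cmod (V j) * cmod (neumann 1 l (A (delta j)) j))
      + 2 * ?a * D j" for j
  proof -
    have 1: "cmod (neumann 1 l (delta j) j) \<le> K 1"
      using neumann_delta_row[of "{j}" 1 j] by simp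
    have "cmod (e j) \<le> 1 / 2 * (cmod (- (V j)\<^sup>2 / l * neumann 1 l (delta j) j)
        + cmod (V j * neumann 1 l (A (delta j)) j)) + cmod (q j j)"
    proof -
      have tri: "cmod (- 1 / 2 * (x + y) + w) \<le> 1 / 2 * (cmod x + cmod y) + cmod w" for x y w
      proof -
        have "cmod (- 1 / 2 * (x + y) + w) \<le> cmod (- 1 / 2 * (x + y)) + cmod w"
          by (rule norm_triangle_ineq)
        also have "cmod (- 1 / 2 * (x + y)) = 1 / 2 * cmod (x + y)"
          by (simp only: norm_mult norm_divide norm_minus_cancel norm_one norm_numeral)
        also have "1 / 2 * cmod (x + y) \<le> 1 / 2 * (cmod x + cmod y)"
          by (intro mult_left_mono norm_triangle_ineq) auto
        finally show ?thesis by simp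
      qed
      show ?thesis unfolding e_eq by (rule tri)
    qed
    also have "cmod (- (V j)\<^sup>2 / l * neumann 1 l (delta j) j) \<le> (cmod (V j))\<^sup>2 * (K 1 / cmod l)"
      using mult_left_mono[OF 1, of "(cmod (V j))\<^sup>2 / cmod l"]
      by (simp add: norm_mult norm_divide norm_power)
    also have "cmod (q j j) \<le> 2 * ?a * D j" by (rule l1_le_point[OF q])
    finally show ?thesis by (simp add: norm_mult)
  qed
  let ?e = "1 / 2 * (S * K 1 / cmod l + K 1 * K 0 * S) + 2 * ?a * ((K 0)\<^sup>2 * S)"
  have e_sum: "(\<Sum>j\<in>G. cmod (e j)) \<le> ?e" if G: "finite G" for G
  proof -
    \<comment> \<open>Each diagonal term is one entry of its column, so the sum over the full square
      \<open>G\<close> times \<open>G\<close> dominates.\<close>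
    have "(\<Sum>j\<in>G. cmod (V j) * cmod (neumann 1 l (A (delta j)) j))
        \<le> (\<Sum>j\<in>G. \<Sum>i\<in>G. cmod (V i) * cmod (neumann 1 l (A (delta j)) i))"
      using G by (intro sum_mono member_le_sum) auto
    also have "\<dots> \<le> K 1 * K 0 * S" by (rule sum_V_neumann_A_delta[OF G G])
    finally have 1: "(\<Sum>j\<in>G. cmod (V j) * cmod (neumann 1 l (A (delta j)) j)) \<le> K 1 * K 0 * S" .
    have "(\<Sum>j\<in>G. cmod (e j)) \<le> (\<Sum>j\<in>G. 1 / 2 * ((cmod (V j))\<^sup>2 * (K 1 / cmod l)
        + cmod (V j) * cmod (neumann 1 l (A (delta j)) j)) + 2 * ?a * D j)"
      by (intro sum_mono e)
    also have "\<dots> = 1 / 2 * ((\<Sum>j\<in>G. (cmod (V j))\<^sup>2) * (K 1 / cmod l)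
        + (\<Sum>j\<in>G. cmod (V j) * cmod (neumann 1 l (A (delta j)) j))) + 2 * ?a * sum D G"
      unfolding sum.distrib sum_distrib_left[symmetric] sum_distrib_right[symmetric] by simp
    also have "\<dots> \<le> 1 / 2 * (S * (K 1 / cmod l) + K 1 * K 0 * S) + 2 * ?a * ((K 0)\<^sup>2 * S)"
      using neumann_bound_nonneg l2_bound_nonneg
      by (intro add_mono mult_left_mono mult_right_mono 1 S G sumD) auto
    finally show ?thesis by simp
  qed
  have sV: "(\<lambda>n. (V n)\<^sup>2) summable_on UNIV"
    using S by (intro abs_summable_of_finite_sums(2)[of _ _ S]) (simp add: norm_power)
  have "(\<Sum>\<^sub>\<infinity>j. M (delta j) j - delta j j) = (\<Sum>\<^sub>\<infinity>j. e j + (- 1 / (2 * l\<^sup>2)) * (V j)\<^sup>2)"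
    by (simp add: e_def)
  also have "\<dots> = infsum e UNIV + (- 1 / (2 * l\<^sup>2)) * (\<Sum>\<^sub>\<infinity>n. (V n)\<^sup>2)"
    by (intro infsumI has_sum_add has_sum_cmult_right has_sum_infsum sV
        abs_summable_of_finite_sums(2)[OF e_sum])
  finally have tr: "(\<Sum>\<^sub>\<infinity>j. M (delta j) j - delta j j) = infsum e UNIV - (\<Sum>\<^sub>\<infinity>n. (V n)\<^sup>2) / (2 * l\<^sup>2)"
    by simp
  have "Dcal V l - (1 - (\<Sum>\<^sub>\<infinity>n. (V n)\<^sup>2) / (2 * l\<^sup>2))
      = (op_det M - (1 + (\<Sum>\<^sub>\<infinity>j. M (delta j) j - delta j j))) + infsum e UNIV"
    unfolding Dcal tr by simp
  also have "cmod \<dots> \<le> (3 / 2 * ((K 0)\<^sup>2 * S))\<^sup>2 + ?e"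
    by (rule order_trans[OF norm_triangle_ineq add_mono[OF det abs_summable_of_finite_sums(4)[OF e_sum]]]) auto
  finally show ?thesis .
qed

end

lemma Dcal_asymptotics:
  fixes V :: "int ^ 'd::finite \<Rightarrow> complex"
  assumes S: "\<And>F. finite F \<Longrightarrow> (\<Sum>n\<in>F. (cmod (V n))\<^sup>2) \<le> S"
  shows "\<exists>Q R. \<forall>l. R \<le> cmod l \<longrightarrow>
    cmod (Dcal V l - (1 - (\<Sum>\<^sub>\<infinity>n. (V n)\<^sup>2) / (2 * l\<^sup>2))) \<le> Q / cmod l ^ 3"
proof (intro exI allI impI)
  fix l :: complex
  let ?d = "real CARD('d)"
  have S0: "0 \<le> S" using S[of "{}"] by simp
  have d: "?d > 0" by simp
  \<comment> \<open>2d makes |l| - d at least |l|/2, hence K_0 <= 2/|l| and K_1 <= 2d/|l|^2. Then 4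
    \<open>sqrt S\<close> gives the contraction constant 1/2, 6S together with |l| >= 1 gives the
    smallness of the column sums, and |l| >= 1 weakens |l|^{-4} to |l|^{-3}.\<close>
  assume R: "2 * ?d + 1 + 4 * sqrt S + 6 * S \<le> cmod l"
  define x where "x = cmod l"
  have x: "2 * ?d \<le> x" "1 \<le> x" "4 * sqrt S \<le> x" "6 * S \<le> x" "x > 0"
    using R S0 d real_sqrt_ge_zero[OF S0] unfolding x_def by linarith+
  have l: "?d < cmod l" using x d unfolding x_def by linarith
  have K0: "neumann_bound ?d 0 l \<le> 2 / x" and K1: "neumann_bound ?d 1 l \<le> 2 * ?d / x\<^sup>2"
    using x d l unfolding x_def[symmetric]
    by (auto simp: neumann_bound_eq x_def[symmetric] field_simps power2_eq_square)
  note K0n = neumann_bound_nonneg[OF l S refl refl, of 0] and K1n = neumann_bound_nonneg[OF l S refl refl, of 1]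
  have K02: "(neumann_bound ?d 0 l)\<^sup>2 * S \<le> 4 * S / x\<^sup>2"
    using mult_right_mono[OF power_mono[OF K0 K0n, of 2] S0] by (simp add: power_divide)
  have a': "sqrt S * neumann_bound ?d 0 l \<le> 2 * sqrt S / x"
    using mult_left_mono[OF K0, of "sqrt S"] S0 by (simp add: mult_ac)
  also have "\<dots> \<le> 1 / 2" using x by (simp add: field_simps)
  finally have a: "sqrt S * neumann_bound ?d 0 l \<le> 1 / 2" .
  have "6 * S * 1 \<le> x * x" using x S0 by (intro mult_mono) auto
  then have "3 / 2 * (4 * S / x\<^sup>2) \<le> 1" using x by (simp add: power2_eq_square)
  then have C: "3 / 2 * ((neumann_bound ?d 0 l)\<^sup>2 * S) \<le> 1" using K02 by linarith
  have x34: "1 / x ^ 4 \<le> 1 / x ^ 3"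
    using x by (intro divide_left_mono power_increasing) auto
  have t1: "(3 / 2 * ((neumann_bound ?d 0 l)\<^sup>2 * S))\<^sup>2 \<le> 36 * S\<^sup>2 / x ^ 3"
  proof -
    have "(3 / 2 * ((neumann_bound ?d 0 l)\<^sup>2 * S))\<^sup>2 \<le> (3 / 2 * (4 * S / x\<^sup>2))\<^sup>2"
      using K02 S0 by (intro power_mono mult_left_mono) auto
    also have "\<dots> = 36 * S\<^sup>2 * (1 / x ^ 4)"
      by (simp add: power2_eq_square power4_eq_xxxx)
    also have "\<dots> \<le> 36 * S\<^sup>2 * (1 / x ^ 3)" by (intro mult_left_mono x34) auto
    finally show ?thesis by simp
  qed
  have t2: "S * neumann_bound ?d 1 l / cmod l \<le> 2 * ?d * S / x ^ 3"
  proof -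
    have "S * neumann_bound ?d 1 l / cmod l \<le> S * (2 * ?d / x\<^sup>2) / x"
      unfolding x_def[symmetric] using K1 S0 x by (intro divide_right_mono mult_left_mono) auto
    then show ?thesis by (simp add: power2_eq_square power3_eq_cube mult_ac)
  qed
  have t3: "neumann_bound ?d 1 l * neumann_bound ?d 0 l * S \<le> 4 * ?d * S / x ^ 3"
  proof -
    have "neumann_bound ?d 1 l * neumann_bound ?d 0 l * S \<le> (2 * ?d / x\<^sup>2) * (2 / x) * S"
      using K0 K1 K0n K1n S0 x by (intro mult_mono mult_nonneg_nonneg) auto
    then show ?thesis by (simp add: power2_eq_square power3_eq_cube mult_ac)
  qed
  have t4: "(sqrt S * neumann_bound ?d 0 l) * ((neumann_bound ?d 0 l)\<^sup>2 * S) \<le> 8 * sqrt S * S / x ^ 3"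
  proof -
    have "(sqrt S * neumann_bound ?d 0 l) * ((neumann_bound ?d 0 l)\<^sup>2 * S) \<le> (2 * sqrt S / x) * (4 * S / x\<^sup>2)"
      using a' K02 S0 x K0n by (intro mult_mono) auto
    then show ?thesis by (simp add: power2_eq_square power3_eq_cube mult_ac)
  qed
  show "cmod (Dcal V l - (1 - (\<Sum>\<^sub>\<infinity>n. (V n)\<^sup>2) / (2 * l\<^sup>2)))
      \<le> (36 * S\<^sup>2 + 3 * ?d * S + 16 * sqrt S * S) / cmod l ^ 3"
  proof -
    note regularized_det_approx[OF l S refl refl a C]
    also have "(3 / 2 * ((neumann_bound ?d 0 l)\<^sup>2 * S))\<^sup>2
        + (1 / 2 * (S * neumann_bound ?d 1 l / cmod l + neumann_bound ?d 1 l * neumann_bound ?d 0 l * S)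
          + 2 * (sqrt S * neumann_bound ?d 0 l) * ((neumann_bound ?d 0 l)\<^sup>2 * S))
        \<le> 36 * S\<^sup>2 / x ^ 3 + (1 / 2 * (2 * ?d * S / x ^ 3 + 4 * ?d * S / x ^ 3) + 2 * (8 * sqrt S * S / x ^ 3))"
      unfolding mult.assoc[of 2 "sqrt S * neumann_bound ?d 0 l"]
      by (intro add_mono mult_left_mono t1 t2 t3 t4) auto
    also have "\<dots> = (36 * S\<^sup>2 + 3 * ?d * S + 16 * sqrt S * S) / cmod l ^ 3"
      using x(5) unfolding x_def[symmetric] by (simp add: field_simps)
    finally show ?thesis .
  qed
qed

subsection \<open>Blaschke products near the origin\<close>

context
  fixes N :: enat and z :: "nat \<Rightarrow> complex"
  assumes z: "\<And>j. j \<in> idx N \<Longrightarrow> 0 < cmod (z j) \<and> cmod (z j) < 1"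
begin

text \<open>At this stage \<open>L\<close> may be 0; it becomes positive only through the
  factorization at the origin. The last property covers arbitrary finite subfamilies, and a single
  factor bounds each |z_j| from below.\<close>

lemma blaschke_moduli_convergent:
  obtains L where "(\<lambda>n. \<Prod>j\<in>idx N \<inter> {..n}. cmod (z j)) \<longlonglongrightarrow> L" "0 \<le> L"
    "\<And>F. finite F \<Longrightarrow> F \<subseteq> idx N \<Longrightarrow> L \<le> (\<Prod>j\<in>F. cmod (z j))"
proof -
  define P where "P n = (\<Prod>j\<in>idx N \<inter> {..n}. cmod (z j))" for n
  have mono: "(\<Prod>j\<in>G. cmod (z j)) \<le> (\<Prod>j\<in>F. cmod (z j))" if "F \<subseteq> G" "finite G" "G \<subseteq> idx N" for F G
  proof -
    have "(\<Prod>j\<in>G. cmod (z j)) = (\<Prod>j\<in>F. cmod (z j)) * (\<Prod>j\<in>G - F. cmod (z j))"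
      using that by (metis mult.commute prod.subset_diff)
    also have "\<dots> \<le> (\<Prod>j\<in>F. cmod (z j)) * 1"
      using that z by (intro mult_left_mono prod_le_1 prod_nonneg) (auto simp: less_imp_le)
    finally show ?thesis by simp
  qed
  have dec: "decseq P"
    unfolding P_def by (intro decseq_SucI mono) auto
  have P0: "0 \<le> P n" for n by (auto simp: P_def intro!: prod_nonneg)
  have conv: "P \<longlonglongrightarrow> lim P"
    using decseq_convergent[OF dec, of 0] P0 by (metis limI)
  show ?thesis
  proof
    show "(\<lambda>n. \<Prod>j\<in>idx N \<inter> {..n}. cmod (z j)) \<longlonglongrightarrow> lim P" using conv unfolding P_def[abs_def] .
    show "0 \<le> lim P" using conv P0 by (intro LIMSEQ_le_const) auto
    fix F assume F: "finite F" "F \<subseteq> idx N"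
    then obtain n where n: "F \<subseteq> {..n}" by (meson finite_nat_iff_bounded_le)
    have "lim P \<le> P n" using decseq_ge[OF dec conv] .
    also have "\<dots> \<le> (\<Prod>j\<in>F. cmod (z j))" unfolding P_def using F n by (intro mono) auto
    finally show "lim P \<le> (\<Prod>j\<in>F. cmod (z j))" .
  qed
qed

context
  fixes L :: real
  assumes L0: "0 < L" and lim: "(\<lambda>n. \<Prod>j\<in>idx N \<inter> {..n}. cmod (z j)) \<longlonglongrightarrow> L"
    and L: "\<And>F. finite F \<Longrightarrow> F \<subseteq> idx N \<Longrightarrow> L \<le> (\<Prod>j\<in>F. cmod (z j))"
begin

lemma moduli_product_le_1: "L \<le> 1"
  using L[of "{}"] by simp

lemma moduli_product_le_cmod: "j \<in> idx N \<Longrightarrow> L \<le> cmod (z j)"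
  using L[of "{j}"] by simp

text \<open>The Blaschke condition in quantitative form, from 1 - x <= -ln x.\<close>

lemma sum_one_minus_cmod_le:
  assumes "finite F" "F \<subseteq> idx N"
  shows "(\<Sum>j\<in>F. 1 - cmod (z j)) \<le> - ln L"
proof -
  have "(\<Sum>j\<in>F. 1 - cmod (z j)) \<le> (\<Sum>j\<in>F. - ln (cmod (z j)))"
  proof (rule sum_mono)
    fix j assume "j \<in> F"
    then show "1 - cmod (z j) \<le> - ln (cmod (z j))"
      using ln_le_minus_one[of "cmod (z j)"] z assms by auto
  qed
  also have "\<dots> = - ln (\<Prod>j\<in>F. cmod (z j))"
    using z assms by (subst ln_prod) (auto simp: sum_negf)
  also have "\<dots> \<le> - ln L" using L[OF assms] L0 by simp
  finally show ?thesis .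
qed

text \<open>The difference equals (1 - |z_j|^{2n}) / z_j^n, which vanishes to first order at the
  unit circle. Bernoulli's inequality makes this linear in 1 - |z_j|, so the Blaschke condition
  yields summability of the difference.\<close>

lemma blaschke_coeff_bound:
  assumes "j \<in> idx N"
  shows "cmod (1 / z j ^ n - cnj (z j) ^ n) \<le> 2 * real n * (1 - cmod (z j)) / L ^ n"
proof -
  define x where "x = cmod (z j)"
  have x: "0 < x" "x < 1" "L \<le> x" using z moduli_product_le_cmod assms by (auto simp: x_def)
  have "1 / z j ^ n - cnj (z j) ^ n = (1 - (z j * cnj (z j)) ^ n) / z j ^ n"
    using x by (auto simp: x_def field_simps power_mult_distrib)
  also have "z j * cnj (z j) = of_real (x\<^sup>2)"
    unfolding x_def by (rule complex_norm_square[symmetric])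
  also have "(1 - complex_of_real (x\<^sup>2) ^ n) / z j ^ n = of_real (1 - x ^ (2 * n)) / z j ^ n"
    by (simp add: power_mult)
  finally have "cmod (1 / z j ^ n - cnj (z j) ^ n) = \<bar>1 - x ^ (2 * n)\<bar> / x ^ n"
    by (simp only: norm_divide norm_of_real norm_power x_def)
  also have "\<bar>1 - x ^ (2 * n)\<bar> = 1 - x ^ (2 * n)"
    using x by (simp add: power_le_one)
  also have "\<dots> \<le> 2 * real n * (1 - x)"
    using Bernoulli_inequality[of "x - 1" "2 * n"] x by (simp add: algebra_simps)
  also have "2 * real n * (1 - x) / x ^ n \<le> 2 * real n * (1 - x) / L ^ n"
    using x L0 by (intro divide_left_mono power_mono mult_pos_pos zero_less_power) auto
  finally show ?thesis using x by (simp add: x_def divide_right_mono)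
qed

lemma blaschke_coeff_summable: "(\<lambda>j. 1 / z j ^ n - cnj (z j) ^ n) summable_on idx N"
proof (rule abs_summable_of_finite_sums(2))
  fix F assume F: "finite F" "F \<subseteq> idx N"
  have "(\<Sum>j\<in>F. cmod (1 / z j ^ n - cnj (z j) ^ n)) \<le> (\<Sum>j\<in>F. 2 * real n / L ^ n * (1 - cmod (z j)))"
    using F blaschke_coeff_bound by (intro sum_mono) auto
  also have "\<dots> \<le> 2 * real n / L ^ n * - ln L"
    unfolding sum_distrib_left[symmetric]
    using F L0 by (intro mult_left_mono sum_one_minus_cmod_le) auto
  finally show "(\<Sum>j\<in>F. cmod (1 / z j ^ n - cnj (z j) ^ n)) \<le> 2 * real n / L ^ n * - ln L" .
qed

text \<open>A factor is |z_j| (1 - w/z_j) / (1 - conj(z_j) w), and for |w| < L <= |z_j| both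
  logarithms expand in powers of w. The resulting double family is dominated by 2 (1 - |z_j|)
  (|w|/L)^n, so it may be summed in either order.\<close>

lemma blaschke_eq_exp:
  assumes w: "cmod w < L"
  shows "(\<lambda>n. Bcoeff N z n * w ^ n) sums (\<Sum>n. Bcoeff N z n * w ^ n)"
    and "blaschke N z w = of_real L * exp (- (\<Sum>n. Bcoeff N z n * w ^ n))"
proof -
  \<comment> \<open>The terms of minus the logarithm of (1 - w/z_j) / (1 - conj(z_j) w). At
    \<open>n = 0\<close> division by zero gives 0, matching the missing constant term.\<close>
  define b where "b j n = 1 / of_nat n * (1 / z j ^ n - cnj (z j) ^ n) * w ^ n" for j n
  let ?q = "cmod w / L"
  have q: "0 \<le> ?q" "?q < 1" using w L0 by auto
  have b: "cmod (b j n) \<le> 2 * (1 - cmod (z j)) * ?q ^ n" if "j \<in> idx N" for j n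
  proof (cases "n = 0")
    case False
    have "cmod (b j n) \<le> 1 / real n * (2 * real n * (1 - cmod (z j)) / L ^ n) * cmod w ^ n"
      unfolding b_def using blaschke_coeff_bound[OF that, of n]
      unfolding norm_mult norm_power
      using z[OF that] L0 by (intro mult_mono) (auto simp: norm_divide)
    then show ?thesis using False by (simp add: power_divide)
  qed (use z[OF that] in \<open>simp add: b_def\<close>)
  have pair: "(\<lambda>(j, n). b j n) summable_on idx N \<times> UNIV"
  proof (rule abs_summable_of_finite_sums(2))
    fix F :: "(nat \<times> nat) set" assume F: "finite F" "F \<subseteq> idx N \<times> UNIV"
    have "(\<Sum>x\<in>F. cmod (case x of (j, n) \<Rightarrow> b j n))
        \<le> (\<Sum>x\<in>fst ` F \<times> snd ` F. cmod (case x of (j, n) \<Rightarrow> b j n))"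
      using F by (intro sum_mono2) (auto intro: rev_image_eqI)
    also have "\<dots> = (\<Sum>j\<in>fst ` F. \<Sum>n\<in>snd ` F. cmod (b j n))"
      by (simp add: sum.cartesian_product split_def)
    also have "\<dots> \<le> (\<Sum>j\<in>fst ` F. \<Sum>n\<in>snd ` F. 2 * (1 - cmod (z j)) * ?q ^ n)"
      using F by (intro sum_mono b) auto
    also have "\<dots> = 2 * (\<Sum>j\<in>fst ` F. 1 - cmod (z j)) * (\<Sum>n\<in>snd ` F. ?q ^ n)"
      by (simp only: sum_distrib_left[symmetric] sum_distrib_right[symmetric] mult.assoc)
    also have "\<dots> \<le> 2 * (- ln L) * (1 / (1 - ?q))"
    proof (intro mult_mono)
      show "(\<Sum>j\<in>fst ` F. 1 - cmod (z j)) \<le> - ln L"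
        using F by (intro sum_one_minus_cmod_le) auto
      show "(\<Sum>n\<in>snd ` F. ?q ^ n) \<le> 1 / (1 - ?q)"
        using sum_le_suminf[of "\<lambda>n. ?q ^ n" "snd ` F"] F q by (simp add: suminf_geometric summable_geometric)
    qed (use q L0 moduli_product_le_1 F less_imp_le[OF conjunct2[OF z]] in \<open>auto intro!: sum_nonneg\<close>)
    finally show "(\<Sum>x\<in>F. cmod (case x of (j, n) \<Rightarrow> b j n)) \<le> 2 * (- ln L) * (1 / (1 - ?q))" .
  qed
  have cols: "(\<Sum>\<^sub>\<infinity>j\<in>idx N. b j n) = Bcoeff N z n * w ^ n" for n
    by (simp only: b_def Bcoeff_def infsum_cmult_left' infsum_cmult_right')
  have col_bound: "cmod (Bcoeff N z n * w ^ n) \<le> 2 * (- ln L) * ?q ^ n" for n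
    unfolding cols[symmetric]
  proof (rule abs_summable_of_finite_sums(4))
    fix F assume F: "finite F" "F \<subseteq> idx N"
    have "(\<Sum>j\<in>F. cmod (b j n)) \<le> (\<Sum>j\<in>F. 2 * (1 - cmod (z j)) * ?q ^ n)"
      using F by (intro sum_mono b) auto
    also have "\<dots> = 2 * (\<Sum>j\<in>F. 1 - cmod (z j)) * ?q ^ n"
      by (simp only: sum_distrib_left sum_distrib_right)
    also have "\<dots> \<le> 2 * (- ln L) * ?q ^ n"
      using F q by (intro mult_right_mono mult_left_mono sum_one_minus_cmod_le) auto
    finally show "(\<Sum>j\<in>F. cmod (b j n)) \<le> 2 * (- ln L) * ?q ^ n" .
  qed
  have sB: "summable (\<lambda>n. cmod (Bcoeff N z n * w ^ n))"
  proof (rule summable_comparison_test'[of "\<lambda>n. 2 * (- ln L) * ?q ^ n" 0])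
    show "summable (\<lambda>n. 2 * (- ln L) * ?q ^ n)"
      using q by (intro summable_mult summable_geometric) auto
  qed (use col_bound in auto)
  show sums: "(\<lambda>n. Bcoeff N z n * w ^ n) sums (\<Sum>n. Bcoeff N z n * w ^ n)"
    using summable_norm_cancel[OF sB] by (rule summable_sums)
  define t where "t j = (\<Sum>\<^sub>\<infinity>n. b j n)" for j
  have total: "(\<Sum>\<^sub>\<infinity>j\<in>idx N. t j) = (\<Sum>n. Bcoeff N z n * w ^ n)"
    unfolding t_def infsum_swap_banach[OF pair] cols
    by (rule infsumI[OF norm_summable_imp_has_sum[OF sB sums]])
  have st: "t summable_on idx N"
    unfolding t_def[abs_def] using summable_on_Sigma_banach[OF pair] by simp
  have factor: "of_real (cmod (z j)) / z j * ((z j - w) / (1 - cnj (z j) * w))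
      = of_real (cmod (z j)) * exp (- t j)" if j: "j \<in> idx N" for j
  proof -
    have zj: "0 < cmod (z j)" "cmod (z j) < 1" "cmod w < cmod (z j)"
      using z[OF j] moduli_product_le_cmod[OF j] w by auto
    have 1: "cmod (- (w / z j)) < 1" using zj by (simp add: norm_divide)
    have "cmod (cnj (z j) * w) \<le> 1 * cmod w" unfolding norm_mult using zj by (intro mult_right_mono) auto
    then have 2: "cmod (- (cnj (z j) * w)) < 1" using zj by simp
    have "(\<lambda>n. - (- ((- (- (w / z j))) ^ n) / of_nat n - - ((- (- (cnj (z j) * w))) ^ n) / of_nat n))
        sums - (ln (1 + - (w / z j)) - ln (1 + - (cnj (z j) * w)))"
      by (intro sums_minus sums_diff Ln_series' 1 2)
    moreover have "- (- ((- (- (w / z j))) ^ n) / of_nat n - - ((- (- (cnj (z j) * w))) ^ n) / of_nat n) = b j n" for n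
      by (cases "n = 0") (simp_all add: b_def field_simps power_divide power_mult_distrib)
    ultimately have s: "b j sums - (ln (1 - w / z j) - ln (1 - cnj (z j) * w))" by simp
    have sn: "summable (\<lambda>n. cmod (b j n))"
      by (rule summable_comparison_test'[of "\<lambda>n. 2 * (1 - cmod (z j)) * ?q ^ n" 0])
        (use q b[OF j] in \<open>auto intro!: summable_mult summable_geometric\<close>)
    have "t j = - (ln (1 - w / z j) - ln (1 - cnj (z j) * w))"
      unfolding t_def by (rule infsumI[OF norm_summable_imp_has_sum[OF sn s]])
    moreover have "1 - w / z j \<noteq> 0" "1 - cnj (z j) * w \<noteq> 0" using 1 2 by auto
    ultimately have "exp (- t j) = (1 - w / z j) / (1 - cnj (z j) * w)" by (simp add: exp_diff)
    moreover have "z j \<noteq> 0" using zj by auto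
    ultimately show ?thesis by (simp add: field_simps)
  qed
  \<comment> \<open>The product is a limit along initial segments; these are cofinal among finite
    index sets, so the unconditional sum of \<open>t\<close> gives its value, for finite and
    infinite \<open>N\<close> alike.\<close>
  have "filterlim (\<lambda>n. idx N \<inter> {..n}) (finite_subsets_at_top (idx N)) sequentially"
    unfolding filterlim_finite_subsets_at_top
  proof (intro allI impI)
    fix X assume X: "finite X \<and> X \<subseteq> idx N"
    then obtain m where m: "X \<subseteq> {..m}" by (meson finite_nat_iff_bounded_le)
    show "\<forall>\<^sub>F n in sequentially. finite (idx N \<inter> {..n}) \<and> X \<subseteq> idx N \<inter> {..n} \<and> idx N \<inter> {..n} \<subseteq> idx N"
      using eventually_ge_at_top[of m] by eventually_elim (use X m in auto)
  qed
  with has_sum_infsum[OF st] have "(\<lambda>n. \<Sum>j\<in>idx N \<inter> {..n}. t j) \<longlonglongrightarrow> (\<Sum>\<^sub>\<infinity>j\<in>idx N. t j)"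
    unfolding has_sum_def by (rule filterlim_compose)
  then have "(\<lambda>n. of_real (\<Prod>j\<in>idx N \<inter> {..n}. cmod (z j)) * exp (- (\<Sum>j\<in>idx N \<inter> {..n}. t j)))
      \<longlonglongrightarrow> of_real L * exp (- (\<Sum>\<^sub>\<infinity>j\<in>idx N. t j))"
    by (intro tendsto_intros lim)
  also have "(\<lambda>n. of_real (\<Prod>j\<in>idx N \<inter> {..n}. cmod (z j)) * exp (- (\<Sum>j\<in>idx N \<inter> {..n}. t j)))
      = (\<lambda>n. \<Prod>j\<in>idx N \<inter> {..n}. of_real (cmod (z j)) / z j * ((z j - w) / (1 - cnj (z j) * w)))"
  proof (rule ext)
    fix n
    have "(\<Prod>j\<in>idx N \<inter> {..n}. of_real (cmod (z j)) / z j * ((z j - w) / (1 - cnj (z j) * w)))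
        = (\<Prod>j\<in>idx N \<inter> {..n}. of_real (cmod (z j)) * exp (- t j))"
      by (intro prod.cong refl factor) auto
    then show "of_real (\<Prod>j\<in>idx N \<inter> {..n}. cmod (z j)) * exp (- (\<Sum>j\<in>idx N \<inter> {..n}. t j))
        = (\<Prod>j\<in>idx N \<inter> {..n}. of_real (cmod (z j)) / z j * ((z j - w) / (1 - cnj (z j) * w)))"
      by (simp add: prod.distrib exp_sum flip: sum_negf)
  qed
  finally show "blaschke N z w = of_real L * exp (- (\<Sum>n. Bcoeff N z n * w ^ n))"
    unfolding blaschke_def total by (rule limI)
qed

end

end

subsection \<open>Taylor coefficients of Herglotz integrals\<close>

text \<open>The kernel is 1 + 2 sum_{n >= 1} e^{-int} w^n, dominated geometrically uniformly in t,
  so it integrates termwise. The density \<open>\<phi>\<close> lets one statement serve both log |D|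
  on the interval and, with \<open>\<phi>\<close> = 1, the singular measure.\<close>

lemma herglotz_sums:
  fixes \<phi> :: "real \<Rightarrow> real"
  assumes \<phi>: "integrable M \<phi>" and cis: "cis \<in> borel_measurable M" and w: "cmod w < 1"
  shows "(\<lambda>n. (if n = 0 then 1 else 2) * (LINT t|M. of_real (\<phi> t) * cis (- t) ^ n) * w ^ n)
    sums (LINT t|M. of_real (\<phi> t) * ((cis t + w) / (cis t - w)))"
proof -
  define c where "c n = (if n = 0 then 1 else 2 :: complex)" for n :: nat
  define f where "f n t = c n * w ^ n * (of_real (\<phi> t) * cis (- t) ^ n)" for n t
  have kernel: "(\<lambda>n. f n t) sums (of_real (\<phi> t) * ((cis t + w) / (cis t - w)))" for t
  proof -
    let ?x = "w * cis (- t)"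
    have x: "cmod ?x < 1" using w by (simp add: norm_mult)
    have "(\<lambda>n. 2 * ?x ^ n - (if n = 0 then 1 else 0)) sums (2 * (1 / (1 - ?x)) - 1)"
      by (intro sums_diff sums_mult geometric_sums x) (use sums_single[of 0 "\<lambda>_. 1 :: complex"] in simp)
    moreover have "2 * (1 / (1 - ?x)) - 1 = (cis t + w) / (cis t - w)"
    proof -
      have inv: "cis (- t) = 1 / cis t" by (simp add: cis_divide[symmetric, of 0, simplified])
      have "cis t - w \<noteq> 0" using w norm_cis[of t] by auto
      then show ?thesis unfolding inv by (simp add: divide_simps)
    qed
    ultimately have "(\<lambda>n. of_real (\<phi> t) * (2 * ?x ^ n - (if n = 0 then 1 else 0)))
        sums (of_real (\<phi> t) * ((cis t + w) / (cis t - w)))"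
      by (intro sums_mult) simp
    moreover have "of_real (\<phi> t) * (2 * ?x ^ n - (if n = 0 then 1 else 0)) = f n t" for n
      by (cases "n = 0") (simp_all add: f_def c_def power_mult_distrib)
    ultimately show ?thesis by simp
  qed
  have norm_f: "cmod (f n t) \<le> 2 * cmod w ^ n * \<bar>\<phi> t\<bar>" for n t
    by (simp add: f_def c_def norm_mult norm_power mult_right_mono)
  have "cis (- t) = cnj (cis t)" for t by (simp add: cis_cnj)
  then have "(\<lambda>t. cis (- t)) \<in> borel_measurable M"
    using cis by (simp add: borel_measurable_continuous_onI continuous_on_cnj measurable_compose[OF cis])
  then have meas: "f n \<in> borel_measurable M" for n
    using \<phi> unfolding f_def by measurable
  have int: "integrable M (f n)" for n
  proof (rule Bochner_Integration.integrable_bound[OF _ meas])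
    show "integrable M (\<lambda>t. 2 * cmod w ^ n * \<bar>\<phi> t\<bar>)" using \<phi> by simp
  qed (use norm_f in auto)
  have geo: "summable (\<lambda>n. 2 * cmod w ^ n * y)" for y
    using w by (intro summable_mult2 summable_mult summable_geometric) auto
  have "(\<lambda>n. integral\<^sup>L M (f n)) sums (LINT t|M. (\<Sum>n. f n t))"
  proof (rule sums_integral[OF int])
    show "AE t in M. summable (\<lambda>n. norm (f n t))"
      using norm_f by (intro always_eventually allI summable_comparison_test'[OF geo, of 0]) auto
    show "summable (\<lambda>n. LINT t|M. norm (f n t))"
    proof (rule summable_comparison_test'[OF geo[of "LINT t|M. \<bar>\<phi> t\<bar>"], of 0])
      fix n
      have "(LINT t|M. norm (f n t)) \<le> (LINT t|M. 2 * cmod w ^ n * \<bar>\<phi> t\<bar>)"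
        using int \<phi> norm_f by (intro integral_mono) auto
      then show "norm (LINT t|M. norm (f n t)) \<le> 2 * cmod w ^ n * (LINT t|M. \<bar>\<phi> t\<bar>)"
        by simp
    qed
  qed
  moreover have "(\<Sum>n. f n t) = of_real (\<phi> t) * ((cis t + w) / (cis t - w))" for t
    using kernel by (simp add: sums_iff)
  moreover have "integral\<^sup>L M (f n) = c n * (LINT t|M. of_real (\<phi> t) * cis (- t) ^ n) * w ^ n" for n
    unfolding f_def by simp
  ultimately show ?thesis by (simp add: c_def)
qed

subsection \<open>The perturbation determinant in the disc near the origin\<close>

text \<open>|V|^2 = |V|^{2-p} |V|^p, where the first factor is bounded because each |V_n|^p is at
  most the whole sum.\<close>

lemma ellp_imp_square_summable:
  assumes V: "V \<in> ellp p" and p: "0 < p" "p \<le> 2"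
  obtains S where "\<And>F. finite F \<Longrightarrow> (\<Sum>n\<in>F. (cmod (V n))\<^sup>2) \<le> S"
proof
  define W where "W = (\<Sum>\<^sub>\<infinity>n. cmod (V n) powr p)"
  have W: "(\<Sum>n\<in>F. cmod (V n) powr p) \<le> W" if "finite F" for F
    using V that unfolding W_def ellp_def by (intro finite_sum_le_infsum) auto
  have sq: "(cmod (V n))\<^sup>2 \<le> W powr ((2 - p) / p) * cmod (V n) powr p" for n
  proof (cases "V n = 0")
    case False
    have "cmod (V n) powr p \<le> W" using W[of "{n}"] by simp
    then have "(cmod (V n) powr p) powr ((2 - p) / p) \<le> W powr ((2 - p) / p)"
      using p by (intro powr_mono2) auto
    moreover have "(cmod (V n) powr p) powr ((2 - p) / p) = cmod (V n) powr (2 - p)"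
      using p by (simp add: powr_powr)
    moreover have "(cmod (V n))\<^sup>2 = cmod (V n) powr (2 - p) * cmod (V n) powr p"
      using False by (simp flip: powr_add)
    ultimately show ?thesis by (simp add: mult_right_mono)
  qed simp
  fix F :: "'a set" assume F: "finite F"
  have "(\<Sum>n\<in>F. (cmod (V n))\<^sup>2) \<le> W powr ((2 - p) / p) * (\<Sum>n\<in>F. cmod (V n) powr p)"
    unfolding sum_distrib_left by (intro sum_mono sq)
  also have "\<dots> \<le> W powr ((2 - p) / p) * W" by (intro mult_left_mono W F) auto
  finally show "(\<Sum>n\<in>F. (cmod (V n))\<^sup>2) \<le> W powr ((2 - p) / p) * W" .
qed

lemma lam_eq: "z \<noteq> 0 \<Longrightarrow> lam d z = of_real d / 2 * (1 + z\<^sup>2) / z"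
  by (simp add: lam_def field_simps power2_eq_square)

lemma filterlim_lam_at_infinity:
  assumes "d \<noteq> 0" shows "filterlim (lam d) at_infinity (at 0)"
proof -
  have "((\<lambda>z :: complex. of_real d / 2 * (1 + z\<^sup>2)) \<longlongrightarrow> of_real d / 2 * (1 + 0\<^sup>2)) (at 0)"
    by (intro tendsto_intros)
  then have "filterlim (\<lambda>z :: complex. of_real d / 2 * (1 + z\<^sup>2) / z) at_infinity (at 0)"
    using assms by (intro filterlim_divide_at_infinity[where c = "of_real d / 2"] filterlim_ident) auto
  then show ?thesis
    by (rule filterlim_mono_eventually[OF _ order_refl order_refl])
      (auto simp: eventually_at_filter lam_eq)
qed

lemma Ddisc_limit:
  fixes V :: "int ^ 'd::finite \<Rightarrow> complex"
  assumes S: "\<And>F. finite F \<Longrightarrow> (\<Sum>n\<in>F. (cmod (V n))\<^sup>2) \<le> S"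
  shows "((\<lambda>z. (Ddisc V z - 1) / z\<^sup>2) \<longlongrightarrow> - (2 / (of_nat CARD('d))\<^sup>2 * (\<Sum>\<^sub>\<infinity>n. (V n)\<^sup>2))) (at 0)"
proof -
  let ?d = "real CARD('d)"
  define T where "T = (\<Sum>\<^sub>\<infinity>n. (V n)\<^sup>2)"
  obtain Q R where QR: "\<And>l. R \<le> cmod l \<Longrightarrow> cmod (Dcal V l - (1 - T / (2 * l\<^sup>2))) \<le> Q / cmod l ^ 3"
    using Dcal_asymptotics[OF S] unfolding T_def by blast
  \<comment> \<open>Exactly -T/(2 lambda(z)^2) divided by z^2. The error Q/|lambda|^3 divided by
    |z|^2 keeps one factor |z|; its constant 8 is 2^3 from lambda = d (1 + z^2)/(2z).\<close>
  define m where "m z = - (2 * T / ((of_nat CARD('d))\<^sup>2 * (1 + z\<^sup>2)\<^sup>2))" for z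
  have "\<forall>\<^sub>F z in at 0. R \<le> cmod (lam ?d z)"
    using filterlim_lam_at_infinity[of ?d] by (simp add: filterlim_at_infinity_conv_norm_at_top filterlim_at_top)
  then have ev: "\<forall>\<^sub>F z in at 0. cmod ((Ddisc V z - 1) / z\<^sup>2 - m z) \<le> 8 * Q / ?d ^ 3 * cmod z / cmod (1 + z\<^sup>2) ^ 3"
    using eventually_neq_at_within[of 0]
  proof eventually_elim
    case (elim z)
    let ?l = "lam ?d z"
    have l: "?l = of_nat CARD('d) / 2 * (1 + z\<^sup>2) / z" using lam_eq[OF elim(2)] by simp
    have "T / (2 * ?l\<^sup>2) = - m z * z\<^sup>2"
      unfolding l m_def by (simp add: power_divide power_mult_distrib)
    then have "(Ddisc V z - 1) / z\<^sup>2 - m z = (Dcal V ?l - (1 - T / (2 * ?l\<^sup>2))) / z\<^sup>2"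
      using elim(2) by (simp add: Ddisc_def field_simps)
    then have "cmod ((Ddisc V z - 1) / z\<^sup>2 - m z) \<le> Q / cmod ?l ^ 3 / cmod (z\<^sup>2)"
      using QR[OF elim(1)] by (simp only: norm_divide divide_right_mono norm_ge_zero)
    also have "\<dots> = 8 * Q / ?d ^ 3 * cmod z / cmod (1 + z\<^sup>2) ^ 3"
      using elim(2) unfolding l
      by (simp add: norm_divide norm_mult norm_power power_divide power_mult_distrib power2_eq_square power3_eq_cube mult_ac)
    finally show ?case .
  qed
  have "((\<lambda>z :: complex. 8 * Q / ?d ^ 3 * cmod z / cmod (1 + z\<^sup>2) ^ 3) \<longlongrightarrow> 8 * Q / ?d ^ 3 * cmod 0 / cmod (1 + 0\<^sup>2) ^ 3) (at 0)"
    by (intro tendsto_intros) auto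
  then have "((\<lambda>z. (Ddisc V z - 1) / z\<^sup>2 - m z) \<longlongrightarrow> 0) (at 0)"
    by (intro Lim_null_comparison[OF ev]) simp
  moreover have "(m \<longlongrightarrow> - (2 * T / ((of_nat CARD('d))\<^sup>2 * (1 + 0\<^sup>2)\<^sup>2))) (at 0)"
    unfolding m_def by (intro tendsto_intros) auto
  ultimately have "((\<lambda>z. ((Ddisc V z - 1) / z\<^sup>2 - m z) + m z) \<longlongrightarrow> 0 + - (2 * T / ((of_nat CARD('d))\<^sup>2 * (1 + 0\<^sup>2)\<^sup>2))) (at 0)"
    by (rule tendsto_add)
  then show ?thesis by (simp add: T_def)
qed

subsection \<open>The branch of the square root in the disc coordinate\<close>

text \<open>If lambda(z) = d c with real |c| <= 1, then z solves z^2 - 2 c z + 1 = 0, whose roots c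
  +- i sqrt(1 - c^2) lie on the unit circle.\<close>

lemma lam_in_Lambda:
  assumes d: "0 < d" and z: "z \<noteq> 0" "cmod z < 1"
  shows "lam d z \<in> Lambda d"
proof (rule ccontr)
  assume "lam d z \<notin> Lambda d"
  then obtain x where x: "-d \<le> x" "x \<le> d" "lam d z = of_real x"
    by (auto simp: Lambda_def)
  define c where "c = x / d"
  have c: "c\<^sup>2 \<le> 1" using x d by (simp add: c_def abs_square_le_1 abs_le_iff divide_le_eq le_divide_eq)
  have "z\<^sup>2 + 1 = 2 * of_real c * z"
    using x(3) z d by (simp add: lam_def c_def field_simps power2_eq_square)
  then have "(z - of_real c)\<^sup>2 = (\<i> * of_real (sqrt (1 - c\<^sup>2)))\<^sup>2"
    using c by (simp add: power_mult_distrib power2_diff flip: of_real_power) (simp add: algebra_simps)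
  then have "z - of_real c = \<i> * of_real (sqrt (1 - c\<^sup>2)) \<or> z - of_real c = - (\<i> * of_real (sqrt (1 - c\<^sup>2)))"
    by (simp only: power2_eq_iff)
  then have "Re z = c \<and> (Im z)\<^sup>2 = (sqrt (1 - c\<^sup>2))\<^sup>2"
    by (auto simp: complex_eq_iff power2_eq_iff)
  then have "(cmod z)\<^sup>2 = c\<^sup>2 + (1 - c\<^sup>2)" using c by (simp add: cmod_power2)
  then show False using z by (simp add: abs_square_eq_1 power2_eq_1_iff)
qed

text \<open>The quotient of the two sides is continuous with values \<open>\<plusminus>1\<close> on the connected punctured disc;
  the behaviour at infinity selects the sign.\<close>

lemma is_kappa_lam:
  assumes d: "0 < d" and k: "is_kappa d \<kappa>" and z: "z \<noteq> 0" "cmod z < 1"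
  shows "\<kappa> (lam d z) = of_real d / 2 * (1 / z - z)"
proof -
  define D where "D = ball (0 :: complex) 1 - {0}"
  define s where "s u = of_real d / 2 * (1 / u - u)" for u :: complex
  define q where "q u = \<kappa> (lam d u) / s u" for u
  have D: "u \<in> D \<longleftrightarrow> u \<noteq> 0 \<and> cmod u < 1" for u by (auto simp: D_def)
  have s0: "s u \<noteq> 0" if "u \<in> D" for u
  proof
    assume "s u = 0"
    then have "u\<^sup>2 = 1" using d that by (auto simp: s_def D power2_eq_square field_simps)
    then have "(cmod u)\<^sup>2 = 1" by (metis norm_one norm_power)
    then have "cmod u = 1" by (smt (verit) norm_ge_zero power2_eq_1_iff)
    then show False using that by (simp add: D)
  qed
  have q2: "q u = 1 \<or> q u = -1" if "u \<in> D" for u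
  proof -
    have "(\<kappa> (lam d u))\<^sup>2 = (lam d u)\<^sup>2 - (of_real d)\<^sup>2"
      using k lam_in_Lambda[OF d] that by (auto simp: is_kappa_def D)
    also have "\<dots> = (s u)\<^sup>2"
      using that by (simp add: lam_def s_def D field_simps power2_eq_square)
    finally have "(q u)\<^sup>2 = 1" using s0[OF that] by (simp add: q_def power_divide)
    then show ?thesis by (simp add: power2_eq_1_iff)
  qed
  have cont: "continuous_on D q"
    unfolding q_def
  proof (intro continuous_on_divide ballI s0)
    have "continuous_on (lam d ` D) \<kappa>"
      using k lam_in_Lambda[OF d]
      by (auto simp: is_kappa_def D intro!: continuous_on_subset[OF holomorphic_on_imp_continuous_on])
    moreover have "continuous_on D (lam d)"
      unfolding lam_def by (intro continuous_intros) (auto simp: D)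
    ultimately show "continuous_on D (\<lambda>u. \<kappa> (lam d u))"
      by (rule continuous_on_compose2) auto
    show "continuous_on D s" unfolding s_def by (intro continuous_intros) (auto simp: D)
  qed
  have "connected D"
    unfolding D_def by (rule connected_punctured_ball) simp
  then have "q constant_on D"
  proof (rule continuous_finite_range_constant[OF _ cont])
    show "finite (q ` D)" by (rule finite_subset[of _ "{1, -1}"]) (use q2 in auto)
  qed
  then obtain c where c: "\<And>u. u \<in> D \<Longrightarrow> q u = c" by (auto simp: constant_on_def)
  have evD: "\<forall>\<^sub>F u in at 0. u \<in> D"
    unfolding eventually_at by (intro exI[of _ 1]) (auto simp: D)
  have inv: "((\<lambda>l. \<kappa> l / l) \<longlongrightarrow> 1) at_infinity"
  proof -
    have "(\<lambda>l. \<kappa> l - (l - (of_real d)\<^sup>2 / (2 * l))) \<in> O[at_infinity](\<lambda>l. 1 / l ^ 3)"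
      using k by (simp add: is_kappa_def)
    then obtain C where C: "\<forall>\<^sub>F l in at_infinity. cmod (\<kappa> l - (l - (of_real d)\<^sup>2 / (2 * l))) \<le> C * cmod (1 / l ^ 3)"
      by (auto elim: landau_o.bigE)
    have i: "((\<lambda>l :: complex. 1 / l) \<longlongrightarrow> 0) at_infinity"
      using tendsto_inverse_0 by (simp add: divide_inverse)
    have "\<forall>\<^sub>F l :: complex in at_infinity. l \<noteq> 0"
      using eventually_not_equal_at_infinity by blast
    with C have "\<forall>\<^sub>F l in at_infinity. cmod (\<kappa> l / l - (1 - (of_real d)\<^sup>2 / 2 * (1 / l) ^ 2)) \<le> C * cmod (1 / l) ^ 4"
    proof eventually_elim
      case (elim l)
      have "\<kappa> l / l - (1 - (of_real d)\<^sup>2 / 2 * (1 / l) ^ 2) = (\<kappa> l - (l - (of_real d)\<^sup>2 / (2 * l))) / l"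
        using elim by (simp add: field_simps power2_eq_square)
      then have "cmod (\<kappa> l / l - (1 - (of_real d)\<^sup>2 / 2 * (1 / l) ^ 2))
          = cmod (\<kappa> l - (l - (of_real d)\<^sup>2 / (2 * l))) / cmod l"
        by (simp only: norm_divide)
      also have "\<dots> \<le> C * cmod (1 / l ^ 3) / cmod l"
        by (rule divide_right_mono[OF elim(1)]) simp
      also have "\<dots> = C * cmod (1 / l) ^ 4"
        by (simp add: norm_divide norm_mult norm_power power_divide power3_eq_cube power4_eq_xxxx mult.assoc)
      finally show ?case .
    qed
    moreover have "((\<lambda>l :: complex. C * cmod (1 / l) ^ 4) \<longlongrightarrow> 0) at_infinity"
      using isCont_tendsto_compose[OF _ i, where g = "\<lambda>x. C * cmod x ^ 4"] by simp
    ultimately have "((\<lambda>l. \<kappa> l / l - (1 - (of_real d)\<^sup>2 / 2 * (1 / l) ^ 2)) \<longlongrightarrow> 0) at_infinity"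
      by (rule Lim_null_comparison)
    moreover have "((\<lambda>l :: complex. 1 - (of_real d)\<^sup>2 / 2 * (1 / l) ^ 2) \<longlongrightarrow> 1 - (of_real d)\<^sup>2 / 2 * 0 ^ 2) at_infinity"
      by (rule isCont_tendsto_compose[OF _ i, where g = "\<lambda>x. 1 - (of_real d)\<^sup>2 / 2 * x ^ 2"])
        (intro continuous_intros, simp)
    ultimately have "((\<lambda>l. (\<kappa> l / l - (1 - (of_real d)\<^sup>2 / 2 * (1 / l) ^ 2)) + (1 - (of_real d)\<^sup>2 / 2 * (1 / l) ^ 2))
        \<longlongrightarrow> 0 + (1 - (of_real d)\<^sup>2 / 2 * 0 ^ 2)) at_infinity"
      by (rule tendsto_add)
    then show ?thesis by simp
  qed
  \<comment> \<open>The candidate branch divided by lambda is (1 - u^2)/(1 + u^2), which tends to 1,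
    so this limit equals the unknown sign \<open>c\<close>.\<close>
  have "((\<lambda>u. \<kappa> (lam d u) / lam d u) \<longlongrightarrow> 1) (at 0)"
    by (rule filterlim_compose[OF inv filterlim_lam_at_infinity]) (use d in simp)
  moreover have "\<forall>\<^sub>F u in at 0. \<kappa> (lam d u) / lam d u = c * ((1 - u\<^sup>2) / (1 + u\<^sup>2))"
    using evD
  proof eventually_elim
    case (elim u)
    have u: "u \<noteq> 0" using elim by (simp add: D)
    have "\<kappa> (lam d u) = c * s u" using c[OF elim] s0[OF elim] by (auto simp: q_def field_simps)
    moreover have "s u = of_real d / 2 * (1 - u\<^sup>2) / u" using u by (simp add: s_def field_simps power2_eq_square)
    ultimately show ?case using u d by (simp add: lam_eq)
  qed
  ultimately have "((\<lambda>u. c * ((1 - u\<^sup>2) / (1 + u\<^sup>2))) \<longlongrightarrow> 1) (at 0)"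
    by (rule Lim_transform_eventually)
  moreover have "((\<lambda>u. c * ((1 - u\<^sup>2) / (1 + u\<^sup>2))) \<longlongrightarrow> c * ((1 - 0\<^sup>2) / (1 + 0\<^sup>2))) (at 0)"
    by (intro tendsto_intros) auto
  ultimately have "1 = c * ((1 - 0\<^sup>2) / (1 + 0\<^sup>2))" by (rule tendsto_unique[OF at_neq_bot])
  then have "c = 1" by simp
  then show ?thesis
    using c[of z] z s0[of z] by (simp add: D q_def s_def)
qed

text \<open>Since lambda + kappa = d/z and lambda - kappa = d z, conjugating only the second
  expression produces 1/z - conj(z). The left-hand sides are the resulting real and imaginary parts
  for the first powers and the squares.\<close>

lemma kappa_lam_identities:
  fixes k l z :: complex
  assumes "l + k = of_real d / z" "l - k = of_real d * z"
  shows "of_real (Re k) + \<i> * of_real (Im l) = of_real d / 2 * (1 / z - cnj z)"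
    and "of_real (Re k * Re l - Im l * Im k) + \<i> * of_real (Re l * Im l + Re k * Im k)
      = of_real d ^ 2 / 4 * (1 / z\<^sup>2 - (cnj z)\<^sup>2)"
proof -
  have "of_real (Re k) + \<i> * of_real (Im l) = 1 / 2 * ((l + k) - cnj (l - k))"
    by (simp add: complex_eq_iff)
  also have "\<dots> = of_real d / 2 * (1 / z - cnj z)"
    unfolding assms by (simp add: algebra_simps)
  finally show "of_real (Re k) + \<i> * of_real (Im l) = of_real d / 2 * (1 / z - cnj z)" .
  have "of_real (Re k * Re l - Im l * Im k) + \<i> * of_real (Re l * Im l + Re k * Im k)
      = 1 / 4 * ((l + k)\<^sup>2 - (cnj (l - k))\<^sup>2)"
    by (simp add: complex_eq_iff power2_eq_square field_simps)
  also have "\<dots> = of_real d ^ 2 / 4 * (1 / z\<^sup>2 - (cnj z)\<^sup>2)"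
    unfolding assms by (simp add: algebra_simps power_divide power_mult_distrib)
  finally show "of_real (Re k * Re l - Im l * Im k) + \<i> * of_real (Re l * Im l + Re k * Im k)
      = of_real d ^ 2 / 4 * (1 / z\<^sup>2 - (cnj z)\<^sup>2)" .
qed

subsection \<open>Trace identities\<close>

text \<open>Near 0 the imaginary part of G stays in the range of the principal logarithm, so
  \<open>Ln\<close> inverts the exponential. This connects the iterated derivatives in
  \<open>psi\<close> with the coefficients of G.\<close>

lemma power_series_log:
  fixes g :: "nat \<Rightarrow> complex"
  assumes r: "0 < r" and G: "\<And>w. cmod w < r \<Longrightarrow> (\<lambda>n. g n * w ^ n) sums G w"
    and f: "\<And>w. cmod w < r \<Longrightarrow> f w = exp (G w)" and g0: "g 0 = 0"
  shows "\<forall>\<^sub>F w in nhds 0. Ln (f w) = G w"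
    and "(deriv ^^ n) (\<lambda>w. Ln (f w)) 0 / fact n = g n"
proof -
  have lim: "(G \<longlongrightarrow> 0) (at 0)" using powser_limit_0[OF r G] g0 by simp
  have "\<forall>\<^sub>F w in at 0. cmod (G w) < 1" using tendstoD[OF lim, of 1] by (simp add: dist_norm)
  moreover have "G 0 = 0" using sums_unique2[OF G[of 0] powser_sums_zero[of g]] r g0 by simp
  ultimately have "\<forall>\<^sub>F w in nhds 0. cmod (G w) < 1"
    by (auto simp: eventually_at_filter elim!: eventually_mono)
  moreover have "\<forall>\<^sub>F w in nhds (0 :: complex). cmod w < r"
    using r eventually_nhds_metric[of "\<lambda>w. cmod w < r" 0] by (auto simp: dist_norm)
  ultimately show ev: "\<forall>\<^sub>F w in nhds 0. Ln (f w) = G w"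
  proof eventually_elim
    case (elim w)
    have "\<bar>Im (G w)\<bar> < pi" using elim(1) abs_Im_le_cmod[of "G w"] pi_gt3 by linarith
    then show ?case using f[OF elim(2)] by (simp add: Ln_exp)
  qed
  have "(\<lambda>w. Ln (f w)) has_fps_expansion Abs_fps g"
  proof (rule has_fps_expansionI)
    show "\<forall>\<^sub>F u in nhds 0. (\<lambda>n. fps_nth (Abs_fps g) n * u ^ n) sums Ln (f u)"
      using ev \<open>\<forall>\<^sub>F w in nhds (0 :: complex). cmod w < r\<close> by eventually_elim (use G in auto)
  qed
  from fps_nth_fps_expansion[OF this, of n] show "(deriv ^^ n) (\<lambda>w. Ln (f w)) 0 / fact n = g n" by simp
qed

text \<open>The logarithm of f differs from f - 1 by O((f - 1)^2), which is negligible after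
  division by w^2. Hence G / w^2 has the limit \<open>q\<close>; its finiteness forces the linear
  coefficient to vanish, and its value is the quadratic one.\<close>

lemma power_series_log_second_order:
  fixes g :: "nat \<Rightarrow> complex"
  assumes r: "0 < r" and G: "\<And>w. cmod w < r \<Longrightarrow> (\<lambda>n. g n * w ^ n) sums G w"
    and f: "\<And>w. cmod w < r \<Longrightarrow> f w = exp (G w)" and g0: "g 0 = 0"
    and lim: "((\<lambda>w. (f w - 1) / w\<^sup>2) \<longlongrightarrow> q) (at 0)"
  shows "g 1 = 0" "g 2 = q"
proof -
  have nz: "\<forall>\<^sub>F w in at (0 :: complex). w \<noteq> 0" by (rule eventually_neq_at_within)
  have id: "((\<lambda>w :: complex. w) \<longlongrightarrow> 0) (at 0)" by (rule tendsto_ident_at)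
  have "((\<lambda>w. (f w - 1) / w\<^sup>2 * w\<^sup>2) \<longlongrightarrow> q * 0\<^sup>2) (at 0)"
    by (intro tendsto_mult lim tendsto_power id)
  moreover have "\<forall>\<^sub>F w in at 0. (f w - 1) / w\<^sup>2 * w\<^sup>2 = f w - 1"
    using nz by eventually_elim simp
  ultimately have "((\<lambda>w. f w - 1) \<longlongrightarrow> q * 0\<^sup>2) (at 0)" by (rule Lim_transform_eventually)
  then have u: "((\<lambda>w. f w - 1) \<longlongrightarrow> 0) (at 0)"
    by simp
  have bound: "\<forall>\<^sub>F w in at 0. cmod (Ln (f w) / w\<^sup>2 - (f w - 1) / w\<^sup>2)
      \<le> cmod ((f w - 1) / w\<^sup>2) * (cmod (f w - 1) / (1 - cmod (f w - 1)))"
    using tendstoD[OF u, of 1, simplified]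
  proof eventually_elim
    case (elim w)
    then have "cmod (Ln (1 + (f w - 1)) - (f w - 1)) \<le> (cmod (f w - 1))\<^sup>2 / (1 - cmod (f w - 1))"
      by (intro Ln_approx_linear) (simp add: dist_norm)
    then have "cmod (Ln (f w) - (f w - 1)) / cmod (w\<^sup>2)
        \<le> (cmod (f w - 1))\<^sup>2 / (1 - cmod (f w - 1)) / cmod (w\<^sup>2)"
      by (intro divide_right_mono) auto
    then show ?case by (simp add: norm_divide power2_eq_square mult_ac flip: diff_divide_distrib)
  qed
  have "((\<lambda>w. cmod ((f w - 1) / w\<^sup>2) * (cmod (f w - 1) / (1 - cmod (f w - 1)))) \<longlongrightarrow> cmod q * (cmod 0 / (1 - cmod 0))) (at 0)"
    by (intro tendsto_mult tendsto_divide tendsto_norm tendsto_diff tendsto_const lim u) simp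
  then have "((\<lambda>w. cmod ((f w - 1) / w\<^sup>2) * (cmod (f w - 1) / (1 - cmod (f w - 1)))) \<longlongrightarrow> 0) (at 0)" by simp
  from Lim_null_comparison[OF bound this] lim
  have "((\<lambda>w. (Ln (f w) / w\<^sup>2 - (f w - 1) / w\<^sup>2) + (f w - 1) / w\<^sup>2) \<longlongrightarrow> 0 + q) (at 0)"
    by (rule tendsto_add)
  then have "((\<lambda>w. Ln (f w) / w\<^sup>2) \<longlongrightarrow> q) (at 0)" by simp
  moreover have "\<forall>\<^sub>F w in at 0. Ln (f w) / w\<^sup>2 = G w / w\<^sup>2"
  proof -
    have "\<forall>\<^sub>F w in nhds 0. Ln (f w) = G w"
      by (rule power_series_log(1)[of r g G f]) (rule r G f g0 | assumption)+
    then have "\<forall>\<^sub>F w in at 0. Ln (f w) = G w" by (simp add: eventually_nhds_conv_at)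
    then show ?thesis by eventually_elim simp
  qed
  ultimately have GG: "((\<lambda>w. G w / w\<^sup>2) \<longlongrightarrow> q) (at 0)" by (rule Lim_transform_eventually)
  have tail1: "(\<lambda>n. g (Suc n) * w ^ n) sums (G w / w)" if "w \<noteq> 0" "cmod w < r" for w
    using sums_divide[OF sums_split_initial_segment[OF G[OF that(2)], of 1], of w] that(1) g0 by simp
  have "((\<lambda>w. G w / w) \<longlongrightarrow> g 1) (at 0)"
    using powser_limit_0_strong[OF r tail1] by simp
  moreover have "((\<lambda>w. G w / w) \<longlongrightarrow> q * 0) (at 0)"
  proof (rule Lim_transform_eventually)
    show "((\<lambda>w. G w / w\<^sup>2 * w) \<longlongrightarrow> q * 0) (at 0)" by (intro tendsto_mult GG id)
    show "\<forall>\<^sub>F w in at 0. G w / w\<^sup>2 * w = G w / w"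
      using nz by eventually_elim (simp add: power2_eq_square)
  qed
  then have "((\<lambda>w. G w / w) \<longlongrightarrow> 0) (at 0)" by simp
  ultimately show g1: "g 1 = 0" by (rule tendsto_unique[OF at_neq_bot])
  have tail2: "(\<lambda>n. g (n + 2) * w ^ n) sums (G w / w\<^sup>2)" if "w \<noteq> 0" "cmod w < r" for w
    using sums_divide[OF sums_split_initial_segment[OF G[OF that(2)], of 2], of "w\<^sup>2"] that(1) g0 g1
    by (simp add: power_add numeral_2_eq_2)
  have "((\<lambda>w. G w / w\<^sup>2) \<longlongrightarrow> g 2) (at 0)"
    using powser_limit_0_strong[OF r tail2] by (simp add: numeral_2_eq_2)
  from tendsto_unique[OF at_neq_bot this GG] show "g 2 = q" .
qed

text \<open>Separate from \<open>blaschke_eq_exp\<close>, which presupposes \<open>0 < L\<close>: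
  this evaluation, valid also for \<open>L = 0\<close>, is used to exclude that case.\<close>

lemma blaschke_0:
  assumes "\<And>j. j \<in> idx N \<Longrightarrow> z j \<noteq> 0"
    and "(\<lambda>n. \<Prod>j\<in>idx N \<inter> {..n}. cmod (z j)) \<longlonglongrightarrow> L"
  shows "blaschke N z 0 = of_real L"
proof -
  have "(\<Prod>j\<in>idx N \<inter> {..n}. of_real (cmod (z j)) / z j * ((z j - 0) / (1 - cnj (z j) * 0)))
      = of_real (\<Prod>j\<in>idx N \<inter> {..n}. cmod (z j))" for n
    unfolding of_real_prod using assms(1) by (intro prod.cong) auto
  then show ?thesis
    unfolding blaschke_def by (simp only:) (rule limI[OF tendsto_of_real[OF assms(2)]])
qed

section \<open>The logarithm of the canonical factorization as a power series\<close>

context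
  fixes V :: "int ^ 'd::finite \<Rightarrow> complex" and N :: enat and z :: "nat \<Rightarrow> complex"
    and \<sigma> :: "real measure"
  assumes zeros: "enumerates_zeros (Ddisc V) N z"
    and sigma: "is_singular_measure V N z \<sigma>"
begin

lemma zero_bounds: "j \<in> idx N \<Longrightarrow> 0 < cmod (z j) \<and> cmod (z j) < 1"
proof -
  assume "j \<in> idx N"
  then have z: "z j \<in> ball 0 1" "Ddisc V (z j) = 0" using zeros by (auto simp: enumerates_zeros_def)
  moreover have "z j \<noteq> 0" using z(2) by (auto simp: Ddisc_def)
  ultimately show ?thesis by simp
qed

lemma log_boundary_integrable:
  "integrable lborel (\<lambda>t. indicator {-pi..pi} t * ln (cmod (Dbdry V t)))"
  using sigma by (simp add: is_singular_measure_def set_integrable_def)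

lemma set_integral_boundary:
  fixes f :: "real \<Rightarrow> complex"
  shows "(LINT t:{-pi..pi}|lborel. f t * of_real (ln (cmod (Dbdry V t))))
    = (LINT t|lborel. of_real (indicator {-pi..pi} t * ln (cmod (Dbdry V t))) * f t)"
  unfolding set_lebesgue_integral_def
  by (intro Bochner_Integration.integral_cong) (auto simp: indicator_def)

lemma sigma_measure:
  shows "finite_measure \<sigma>" "space \<sigma> = {-pi..pi}" "cis \<in> borel_measurable \<sigma>"
proof -
  have s: "sets \<sigma> = sets (restrict_space borel {-pi..pi})"
    using sigma by (simp add: is_singular_measure_def)
  show "finite_measure \<sigma>" using sigma by (simp add: is_singular_measure_def)
  show "space \<sigma> = {-pi..pi}" using sets_eq_imp_space_eq[OF s] by (simp add: space_restrict_space)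
  have "cis \<in> borel_measurable borel"
    by (intro borel_measurable_continuous_onI continuous_intros)
  then show "cis \<in> borel_measurable \<sigma>"
    by (subst measurable_cong_sets[OF s refl]) (rule measurable_restrict_space1)
qed

abbreviation "fourier n \<equiv> mu_integral V \<sigma> (\<lambda>t. cis (- t) ^ n)"

lemma fourier_0:
  "fourier 0 = of_real ((LINT t:{-pi..pi}|lborel. ln (cmod (Dbdry V t))) - measure \<sigma> (space \<sigma>))"
proof -
  have "(LINT t:{-pi..pi}|lborel. complex_of_real (ln (cmod (Dbdry V t))))
      = of_real (LINT t:{-pi..pi}|lborel. ln (cmod (Dbdry V t)))"
    by (rule set_integral_complex_of_real)
  then show ?thesis by (simp add: mu_integral_def scaleR_conv_of_real)
qed

text \<open>Both exponentials merge into one, whose series has coefficient 1/(2 pi) at n = 0 and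
  1/pi afterwards, because of the doubling in the Herglotz kernel.\<close>

lemma canonical_factorization:
  assumes w: "cmod w < 1"
  shows "(\<lambda>n. (if n = 0 then 1 else 2) * fourier n * w ^ n / (2 * pi)) sums
      (\<Sum>n. (if n = 0 then 1 else 2) * fourier n * w ^ n / (2 * pi))"
    and "Ddisc V w = blaschke N z w * exp (\<Sum>n. (if n = 0 then 1 else 2) * fourier n * w ^ n / (2 * pi))"
proof -
  define J where "J = (LINT t:{-pi..pi}|lborel. (cis t + w) / (cis t - w) * of_real (ln (cmod (Dbdry V t))))"
  define K where "K = (LINT t|\<sigma>. (cis t + w) / (cis t - w))"
  have "cis \<in> borel_measurable lborel"
    using borel_measurable_continuous_onI[of cis] by (simp add: continuous_intros)
  note 1 = herglotz_sums[OF log_boundary_integrable this w, folded set_integral_boundary, folded J_def]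
  have "integrable \<sigma> (\<lambda>_. 1 :: real)"
    using sigma_measure(1) by (simp add: finite_measure.integrable_const)
  from herglotz_sums[OF this sigma_measure(3) w]
  have 2: "(\<lambda>n. (if n = 0 then 1 else 2) * (LINT t|\<sigma>. cis (- t) ^ n) * w ^ n) sums K"
    by (simp add: K_def)
  have "(\<lambda>n. ((if n = 0 then 1 else 2) * (LINT t:{-pi..pi}|lborel. cis (- t) ^ n * of_real (ln (cmod (Dbdry V t)))) * w ^ n
      - (if n = 0 then 1 else 2) * (LINT t|\<sigma>. cis (- t) ^ n) * w ^ n) / (2 * pi)) sums ((J - K) / (2 * pi))"
    by (intro sums_divide sums_diff 1 2)
  then have s: "(\<lambda>n. (if n = 0 then 1 else 2) * fourier n * w ^ n / (2 * pi)) sums ((J - K) / (2 * pi))"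
    by (simp only: mu_integral_def left_diff_distrib right_diff_distrib)
  then show "(\<lambda>n. (if n = 0 then 1 else 2) * fourier n * w ^ n / (2 * pi)) sums
      (\<Sum>n. (if n = 0 then 1 else 2) * fourier n * w ^ n / (2 * pi))"
    by (simp add: sums_iff)
  have "Ddisc V w = blaschke N z w * exp (- (1 / (2 * of_real pi)) * K) * exp (1 / (2 * of_real pi) * J)"
    using sigma w unfolding is_singular_measure_def J_def K_def by simp
  also have "\<dots> = blaschke N z w * exp ((J - K) / (2 * pi))"
    by (simp add: mult.assoc flip: exp_add) (simp add: diff_divide_distrib)
  finally show "Ddisc V w = blaschke N z w * exp (\<Sum>n. (if n = 0 then 1 else 2) * fourier n * w ^ n / (2 * pi))"
    using s by (simp add: sums_iff)
qed

lemma log_determinant_series: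
  obtains L G where "0 < L" "L \<le> 1"
    "(\<lambda>n. \<Prod>j\<in>idx N \<inter> {..n}. cmod (z j)) \<longlonglongrightarrow> L"
    "\<And>j. j \<in> idx N \<Longrightarrow> L \<le> cmod (z j)"
    "\<And>n. (\<lambda>j. 1 / z j ^ n - cnj (z j) ^ n) summable_on idx N"
    "of_real (ln L) + fourier 0 / (2 * pi) = 0"
    "\<And>w. cmod w < L \<Longrightarrow> (\<lambda>n. (if n = 0 then 0 else fourier n / pi - Bcoeff N z n) * w ^ n) sums G w"
    "\<And>w. cmod w < L \<Longrightarrow> Ddisc V w = exp (G w)"
proof -
  obtain L where L: "(\<lambda>n. \<Prod>j\<in>idx N \<inter> {..n}. cmod (z j)) \<longlonglongrightarrow> L" "0 \<le> L"
    "\<And>F. finite F \<Longrightarrow> F \<subseteq> idx N \<Longrightarrow> L \<le> (\<Prod>j\<in>F. cmod (z j))"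
    using blaschke_moduli_convergent[of N z, OF zero_bounds] by blast
  let ?c = "\<lambda>n. (if n = 0 then 1 else 2) * fourier n / (2 * pi) :: complex"
  have b0: "blaschke N z 0 = of_real L"
    using zero_bounds L(1) by (intro blaschke_0) fastforce
  have "(\<Sum>n. (if n = 0 then 1 else 2) * fourier n * 0 ^ n / (2 * pi)) = ?c 0"
    using powser_zero[of ?c] by simp
  then have D0: "1 = of_real L * exp (fourier 0 / (2 * pi))"
    using canonical_factorization(2)[of 0] b0 by (simp add: Ddisc_def)
  then have L0: "0 < L" using L(2) by (cases "L = 0") auto
  note ctx = zero_bounds L0 L(1) L(3)
  define x where "x = ((LINT t:{-pi..pi}|lborel. ln (cmod (Dbdry V t))) - measure \<sigma> (space \<sigma>)) / (2 * pi)"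
  \<comment> \<open>Reality matters here: for a complex exponent, exp = 1 would determine it only
    modulo 2 pi i.\<close>
  have x: "fourier 0 / (2 * pi) = of_real x" unfolding x_def fourier_0 by simp
  have "complex_of_real (exp (ln L + x)) = 1"
    using D0 L0 unfolding x by (simp add: exp_add exp_of_real)
  then have norm: "of_real (ln L) + fourier 0 / (2 * pi) = 0"
    unfolding x by (simp flip: of_real_add)
  define G where "G w = - (\<Sum>n. Bcoeff N z n * w ^ n) + (\<Sum>n. (if n = 0 then 1 else 2) * fourier n * w ^ n / (2 * pi)) + of_real (ln L)" for w
  show ?thesis
  proof
    show "0 < L" by fact
    show "L \<le> 1" using L(3)[of "{}"] by simp
    show "(\<lambda>n. \<Prod>j\<in>idx N \<inter> {..n}. cmod (z j)) \<longlonglongrightarrow> L" by fact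
    show "L \<le> cmod (z j)" if "j \<in> idx N" for j using L(3)[of "{j}"] that by simp
    show "(\<lambda>j. 1 / z j ^ n - cnj (z j) ^ n) summable_on idx N" for n
      by (rule blaschke_coeff_summable[where N = N and z = z, OF ctx])
    show "of_real (ln L) + fourier 0 / (2 * pi) = 0" by (rule norm)
    fix w assume w: "cmod w < L"
    have w1: "cmod w < 1" using w L(3)[of "{}"] by simp
    have "(\<lambda>n. - (Bcoeff N z n * w ^ n) + (if n = 0 then 1 else 2) * fourier n * w ^ n / (2 * pi)
        + (if n = 0 then of_real (ln L) else 0)) sums G w"
      unfolding G_def
      by (intro sums_add sums_minus blaschke_eq_exp(1)[where N = N and z = z, OF ctx w] canonical_factorization(1)[OF w1])
        (assumption | rule sums_single[of 0 "\<lambda>_. complex_of_real (ln L)"])+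
    \<comment> \<open>At \<open>n = 0\<close>, \<open>Bcoeff\<close> is 0 by division by zero, and
      the other two constants cancel by \<open>norm\<close>; thus G(0) = 0, as the branch of log D
      requires.\<close>
    moreover have "- (Bcoeff N z n * w ^ n) + (if n = 0 then 1 else 2) * fourier n * w ^ n / (2 * pi)
        + (if n = 0 then of_real (ln L) else 0) = (if n = 0 then 0 else fourier n / pi - Bcoeff N z n) * w ^ n" for n
      using norm by (simp add: Bcoeff_def add.commute) (simp add: field_simps)
    ultimately show "(\<lambda>n. (if n = 0 then 0 else fourier n / pi - Bcoeff N z n) * w ^ n) sums G w"
      by simp
    have "blaschke N z w = of_real L * exp (- (\<Sum>n. Bcoeff N z n * w ^ n))"
      by (rule blaschke_eq_exp(2)[OF ctx w]) assumption+
    then show "Ddisc V w = exp (G w)"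
      unfolding canonical_factorization(2)[OF w1] G_def
      using L0 by (simp add: exp_add exp_diff exp_minus exp_of_real field_simps)
  qed
qed

end

theorem theorem1p3:
  fixes V :: "int ^ 'd::finite \<Rightarrow> complex"
    and p :: real
    and N :: enat
    and z :: "nat \<Rightarrow> complex"
    and \<sigma> :: "real measure"
    and \<kappa> :: "complex \<Rightarrow> complex"
  assumes d_ge_3: "CARD('d) \<ge> 3"
    and p_ge_1: "1 \<le> p"
    and p_dim_3: "CARD('d) = 3 \<longrightarrow> p < 6 / 5"
    and p_dim_4: "CARD('d) \<ge> 4 \<longrightarrow> p < 4 / 3"
    and V_ellp: "V \<in> ellp p"
    and zeros: "enumerates_zeros (Ddisc V) N z"
    and sigma: "is_singular_measure V N z \<sigma>"
    and kappa: "is_kappa (real CARD('d)) \<kappa>"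
  shows
    "(\<lambda>n. \<Prod>j\<in>idx N \<inter> {..n}. cmod (z j)) \<longlonglongrightarrow> exp (B0 N z)
     \<and> Ln (blaschke N z 0) = of_real (B0 N z)
     \<and> (N \<ge> 1 \<longrightarrow> B0 N z < 0)
     \<and> measure \<sigma> (space \<sigma>) / (2 * pi) - B0 N z
           = 1 / (2 * pi) * (LINT t:{-pi..pi}|lborel. ln (cmod (Dbdry V t)))
     \<and> 1 / (2 * pi) * (LINT t:{-pi..pi}|lborel. ln (cmod (Dbdry V t))) \<ge> 0
     \<and> (\<forall>n\<ge>1. (\<lambda>j. 1 / z j ^ n - cnj (z j) ^ n) summable_on idx N)
     \<and> Bcoeff N z 1 = (\<Sum>\<^sub>\<infinity>j\<in>idx N. 1 / z j - cnj (z j))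
     \<and> (\<Sum>\<^sub>\<infinity>j\<in>idx N. 1 / z j - cnj (z j))
           = 1 / of_real pi * mu_integral V \<sigma> (\<lambda>t. exp (- \<i> * of_real t))
     \<and> 1 / 2 * (\<Sum>\<^sub>\<infinity>j\<in>idx N. 1 / (z j)\<^sup>2 - (cnj (z j))\<^sup>2)
           = 2 / (of_nat CARD('d))\<^sup>2 * op_trace (mult_op V \<circ> mult_op V)
             + 1 / of_real pi * mu_integral V \<sigma> (\<lambda>t. exp (- 2 * \<i> * of_real t))
     \<and> (\<forall>n\<ge>2. Bcoeff N z n
           = psi V n + 1 / of_real pi * mu_integral V \<sigma> (\<lambda>t. exp (- \<i> * of_nat n * of_real t)))
     \<and> (let l = (\<lambda>j. lam (real CARD('d)) (z j));
            k = (\<lambda>j. \<kappa> (l j));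
            a = (\<lambda>j. complex_of_real (Re (k j)) + \<i> * of_real (Im (l j)));
            b = (\<lambda>j. complex_of_real (Re (k j) * Re (l j) - Im (l j) * Im (k j))
                      + \<i> * of_real (Re (l j) * Im (l j) + Re (k j) * Im (k j)))
        in a summable_on idx N
         \<and> (\<Sum>\<^sub>\<infinity>j\<in>idx N. a j)
             = of_nat CARD('d) / (2 * of_real pi)
               * mu_integral V \<sigma> (\<lambda>t. exp (- \<i> * of_real t))
         \<and> b summable_on idx N
         \<and> 1 / 2 * (\<Sum>\<^sub>\<infinity>j\<in>idx N. b j)
             = 1 / 2 * op_trace (mult_op V \<circ> mult_op V)
               + (of_nat CARD('d))\<^sup>2 / (4 * of_real pi)
                 * mu_integral V \<sigma> (\<lambda>t. exp (- 2 * \<i> * of_real t)))"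
proof -
  let ?d = "real CARD('d)"
  have p: "0 < p" "p \<le> 2"
    using p_ge_1 p_dim_3 p_dim_4 d_ge_3 by (cases "CARD('d) = 3"; force)+
  obtain S where S: "\<And>F. finite F \<Longrightarrow> (\<Sum>n\<in>F. (cmod (V n))\<^sup>2) \<le> S"
    using ellp_imp_square_summable[OF V_ellp p] by blast
  define T where "T = op_trace (mult_op V \<circ> mult_op V)"
  have T: "T = (\<Sum>\<^sub>\<infinity>n. (V n)\<^sup>2)"
    by (simp add: T_def op_trace_def mult_op_def delta_def power2_eq_square)
  define F where "F n = mu_integral V \<sigma> (\<lambda>t. cis (- t) ^ n)" for n
  obtain L G where L: "0 < L" "L \<le> 1"
    and lim: "(\<lambda>n. \<Prod>j\<in>idx N \<inter> {..n}. cmod (z j)) \<longlonglongrightarrow> L"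
    and L_le: "\<And>j. j \<in> idx N \<Longrightarrow> L \<le> cmod (z j)"
    and summ: "\<And>n. (\<lambda>j. 1 / z j ^ n - cnj (z j) ^ n) summable_on idx N"
    and norm: "of_real (ln L) + F 0 / (2 * pi) = 0"
    and G: "\<And>w. cmod w < L \<Longrightarrow> (\<lambda>n. (if n = 0 then 0 else F n / pi - Bcoeff N z n) * w ^ n) sums G w"
    and D: "\<And>w. cmod w < L \<Longrightarrow> Ddisc V w = exp (G w)"
    unfolding F_def by (rule log_determinant_series[OF zeros sigma]) blast
  note zb = zero_bounds[OF zeros sigma]
  define g where "g n = (if n = 0 then 0 else F n / pi - Bcoeff N z n)" for n
  note G' = G[folded g_def]
  have g0: "g 0 = 0" by (simp add: g_def)
  have psi: "psi V n = - g n" for n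
    unfolding psi_def using power_series_log(2)[of L g G "Ddisc V", OF L(1) G' D g0] by simp
  have lim2: "((\<lambda>w. (Ddisc V w - 1) / w\<^sup>2) \<longlongrightarrow> - (2 / (of_nat CARD('d))\<^sup>2 * T)) (at 0)"
    unfolding T by (rule Ddisc_limit[OF S])
  have g12: "g 1 = 0" "g 2 = - (2 / (of_nat CARD('d))\<^sup>2 * T)"
    using power_series_log_second_order[of L g G "Ddisc V", OF L(1) G' D g0 lim2] by auto
  have B0: "B0 N z = ln L" unfolding B0_def by (simp add: limI[OF lim])
  have bl: "blaschke N z 0 = of_real L"
    using zb by (intro blaschke_0 lim) fastforce
  have Bn: "Bcoeff N z n = F n / pi - g n" if "n \<ge> 1" for n using that by (simp add: g_def)
  define I where "I = (LINT t:{-pi..pi}|lborel. ln (cmod (Dbdry V t)))"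
  have "complex_of_real (ln L + (I - measure \<sigma> (space \<sigma>)) / (2 * pi)) = 0"
    using norm unfolding F_def fourier_0[OF zeros sigma] I_def by simp
  then have I: "ln L + (I - measure \<sigma> (space \<sigma>)) / (2 * pi) = 0" by (simp only: of_real_eq_0_iff)
  then have I1: "measure \<sigma> (space \<sigma>) / (2 * pi) - B0 N z = 1 / (2 * pi) * I"
    by (simp add: B0 diff_divide_distrib)
  \<comment> \<open>The integral inherits its sign from the other side of the identity, where the
    mass of \<open>\<sigma>\<close> and -ln L are both nonnegative.\<close>
  have "ln L \<le> 0" using L by simp
  then have I2: "1 / (2 * pi) * I \<ge> 0" unfolding I1[symmetric] B0
    by (smt (verit) divide_nonneg_nonneg measure_nonneg pi_ge_zero)
  have neg: "B0 N z < 0" if "N \<ge> 1"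
  proof -
    have "1 \<in> idx N" using that by (simp add: idx_def one_enat_def)
    then have "L < 1" using L_le zb by fastforce
    then show ?thesis using L B0 by simp
  qed
  have F1: "mu_integral V \<sigma> (\<lambda>t. exp (- \<i> * of_real t)) = F 1"
    by (simp add: F_def cis_conv_exp)
  have Fn: "mu_integral V \<sigma> (\<lambda>t. exp (- \<i> * of_nat n * of_real t)) = F n" for n
    by (simp add: F_def cis_conv_exp mult_ac flip: exp_of_nat_mult)
  have F2: "mu_integral V \<sigma> (\<lambda>t. exp (- 2 * \<i> * of_real t)) = F 2"
    using Fn[of 2] by (simp add: mult_ac)
  have S1: "(\<Sum>\<^sub>\<infinity>j\<in>idx N. 1 / z j - cnj (z j)) = 1 / of_real pi * F 1"
    using Bn[of 1] g12 by (simp add: Bcoeff_def)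
  \<comment> \<open>The factor 1/2 is the 1/n in B_n at n = 2, and (2/d^2) T is psi_2.\<close>
  have S2: "1 / 2 * (\<Sum>\<^sub>\<infinity>j\<in>idx N. 1 / (z j)\<^sup>2 - (cnj (z j))\<^sup>2)
      = 2 / (of_nat CARD('d))\<^sup>2 * T + 1 / of_real pi * F 2"
    using Bn[of 2] g12 by (simp add: Bcoeff_def)
  define l where "l j = lam ?d (z j)" for j
  define k where "k j = \<kappa> (l j)" for j
  define a where "a j = complex_of_real (Re (k j)) + \<i> * of_real (Im (l j))" for j
  define b where "b j = complex_of_real (Re (k j) * Re (l j) - Im (l j) * Im (k j))
      + \<i> * of_real (Re (l j) * Im (l j) + Re (k j) * Im (k j))" for j
  \<comment> \<open>The explicit exponents match the summands of \<open>summ\<close>, from which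
    summability and values of both series are transferred.\<close>
  have ab: "a j = of_nat CARD('d) / 2 * (1 / z j ^ 1 - cnj (z j) ^ 1)"
    "b j = (of_nat CARD('d))\<^sup>2 / 4 * (1 / z j ^ 2 - cnj (z j) ^ 2)" if "j \<in> idx N" for j
  proof -
    have zj: "z j \<noteq> 0" "cmod (z j) < 1" using zb[OF that] by auto
    have k: "k j = of_real ?d / 2 * (1 / z j - z j)"
      unfolding k_def l_def by (rule is_kappa_lam[OF _ kappa zj]) simp
    have "l j + k j = of_real ?d / z j" "l j - k j = of_real ?d * z j"
      using zj unfolding k by (simp_all add: l_def lam_def field_simps)
    from kappa_lam_identities[OF this]
    show "a j = of_nat CARD('d) / 2 * (1 / z j ^ 1 - cnj (z j) ^ 1)"
      "b j = (of_nat CARD('d))\<^sup>2 / 4 * (1 / z j ^ 2 - cnj (z j) ^ 2)"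
      by (simp_all add: a_def b_def)
  qed
  have a_sum: "a summable_on idx N"
    using summable_on_cmult_right[OF summ[of 1], of "of_nat CARD('d) / 2"]
    by (rule summable_on_cong[THEN iffD2, rotated]) (rule ab)
  have b_sum: "b summable_on idx N"
    using summable_on_cmult_right[OF summ[of 2], of "(of_nat CARD('d))\<^sup>2 / 4"]
    by (rule summable_on_cong[THEN iffD2, rotated]) (rule ab)
  have "(\<Sum>\<^sub>\<infinity>j\<in>idx N. a j) = (\<Sum>\<^sub>\<infinity>j\<in>idx N. of_nat CARD('d) / 2 * (1 / z j ^ 1 - cnj (z j) ^ 1))"
    by (rule infsum_cong) (rule ab)
  then have a_val: "(\<Sum>\<^sub>\<infinity>j\<in>idx N. a j) = of_nat CARD('d) / (2 * of_real pi) * F 1"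
    using S1 unfolding infsum_cmult_right' by simp
  have "(\<Sum>\<^sub>\<infinity>j\<in>idx N. b j) = (\<Sum>\<^sub>\<infinity>j\<in>idx N. (of_nat CARD('d))\<^sup>2 / 4 * (1 / z j ^ 2 - cnj (z j) ^ 2))"
    by (rule infsum_cong) (rule ab)
  also have "\<dots> = (of_nat CARD('d))\<^sup>2 / 2 * (1 / 2 * (\<Sum>\<^sub>\<infinity>j\<in>idx N. 1 / z j ^ 2 - cnj (z j) ^ 2))"
    unfolding infsum_cmult_right' by simp
  finally have b_eq: "(\<Sum>\<^sub>\<infinity>j\<in>idx N. b j)
      = (of_nat CARD('d))\<^sup>2 / 2 * (2 / (of_nat CARD('d))\<^sup>2 * T + 1 / of_real pi * F 2)"
    unfolding S2 .
  have b_val: "1 / 2 * (\<Sum>\<^sub>\<infinity>j\<in>idx N. b j)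
      = 1 / 2 * T + (of_nat CARD('d))\<^sup>2 / (4 * of_real pi) * F 2"
    unfolding b_eq by (simp add: field_simps)
  show ?thesis
    unfolding F1 F2 Fn Let_def T_def[symmetric] I_def[symmetric] l_def[symmetric] k_def[symmetric]
      a_def[symmetric] b_def[symmetric]
  proof (intro conjI allI impI)
    show "(\<lambda>n. \<Prod>j\<in>idx N \<inter> {..n}. cmod (z j)) \<longlonglongrightarrow> exp (B0 N z)" using lim L B0 by simp
    show "Ln (blaschke N z 0) = of_real (B0 N z)" using L by (simp add: bl B0 Ln_of_real)
    show "Bcoeff N z 1 = (\<Sum>\<^sub>\<infinity>j\<in>idx N. 1 / z j - cnj (z j))" by (simp add: Bcoeff_def)
    show "Bcoeff N z n = psi V n + 1 / of_real pi * F n" if "2 \<le> n" for n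
      using Bn[of n] that psi[of n] by simp
  qed (use neg I1 I2 summ S1 S2 a_sum a_val b_sum b_val in auto)
qed

end
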